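(* Fix vertex conditions $(P,T)$ (independent of $\varepsilon$) and let $\mathcal{H}_\varepsilon$ be the corresponding operator described in the context. As $\varepsilon\to0+$, the normalized eigenfunctions $\psi$ (with $\|\psi\|_{L_2(\Gamma_\varepsilon)}=1$) of the operator $\mathcal{H}_\varepsilon$ associated with its negative eigenvalues satisfy $$\big\|\psi|_{s_\varepsilon}\big\|^2=O(\varepsilon),\qquad \big\|\psi|_{e}\big\|^2=1+O(\varepsilon)\qquad\text{for an eigenvalue of type (B)},$$ $$\big\|\psi|_{s_\varepsilon}\big\|^2=1+O(\varepsilon^{1/2}),\qquad \big\|\psi|_{e}\big\|^2=O(\varepsilon^{1/2})\qquad\text{for an eigenvalue of type (S)},$$ $$\big\|\psi|_{s_\varepsilon}\big\|^2=\tfrac{2}{3}+O(\varepsilon^{1/3}),\qquad \big\|\psi|_{e}\big\|^2=\tfrac{1}{3}+O(\varepsilon^{1/3})\qquad\text{for an eigenvalue of type (C)},$$ where the norms are those of $L_2(s_\varepsilon)$ and $L_2(e)$ respectively.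
   Context: Let $\varepsilon>0$ be a small parameter. The metric graph $\Gamma_\varepsilon$ consists of a short edge $s_\varepsilon=(0,\varepsilon)$ (coordinate $x_\varepsilon$) and an edge $e=(0,1)$ (coordinate $x$), joined at a central vertex $v_c$ corresponding to $x_\varepsilon=\varepsilon$ and $x=1$. Set $L_2(\Gamma_\varepsilon)=L_2(s_\varepsilon)\oplus L_2(e)$. Let $P$ be an arbitrary orthogonal projection in $\mathbb{C}^2$, $Q:=I-P$, and let $T$ be an arbitrary self-adjoint operator on the range of $Q$; $P$ and $T$ do not depend on $\varepsilon$. The self-adjoint operator $\mathcal{H}_\varepsilon$ on $L_2(\Gamma_\varepsilon)$ acts as $$\mathcal{H}_\varepsilon(u_\varepsilon,u)=\left(-\frac{d^2u_\varepsilon}{dx_\varepsilon^2},\,-\frac{d^2u}{dx^2}\right)$$ on the domain of all $(u_\varepsilon,u)\in H^2(s_\varepsilon)\oplus H^2(e)$ with $$u_\varepsilon'(0)=0,\qquad u(0)=0,\qquad PU=0,\qquad QU'=TQU,$$ $$U:=\begin{pmatrix}u_\varepsilon(\varepsilon)\\ u(1)\end{pmatrix},\qquad U':=\begin{pmatrix}-u_\varepsilon'(\varepsilon)\\ -u'(1)\end{pmatrix}.$$ Types of negative eigenvalues. Below $\Lambda_0$ denotes a function holomorphic at $0$ with $\Lambda_0(0)\ne0$, $\Lambda_1$ a smooth function with $\Lambda_1(s)=O(e^{-C/s})$ for small positive $s$ and some constant $C>0$, and $\alpha>0$ a real constant, all independent of $\varepsilon$. A negative eigenvalue $\lambda(\varepsilon)$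 of $\mathcal{H}_\varepsilon$ (defined for all sufficiently small $\varepsilon>0$) is said to be - of type (B) if $\lambda(\varepsilon)=-\Lambda_0^2(\varepsilon)=-\alpha+O(\varepsilon)$; - of type (S) if $\lambda(\varepsilon)=-\varepsilon^{-1}\big(\Lambda_0(\varepsilon^{1/2})+\Lambda_1(\varepsilon^{1/2})\big)^2=-\alpha\varepsilon^{-1}+O(\varepsilon^{-1/2})$; - of type (C) if $\lambda(\varepsilon)=-\varepsilon^{-2/3}\big(\Lambda_0(\varepsilon^{1/3})+\Lambda_1(\varepsilon^{1/3})\big)^2=-\alpha\varepsilon^{-2/3}+O(\varepsilon^{-1/3})$. *)

theory Defs
  imports "HOL-Analysis.Analysis" "HOL-Library.Landau_Symbols"
begin

section \<open>Lebesgue and Sobolev spaces on a bounded interval\<close>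

text \<open>
  Elements of the spaces over \<open>(a, b)\<close> are represented by functions on the whole real line; only
  their values almost everywhere on \<open>(a, b)\<close> matter.
\<close>

definition L2_on :: "real \<Rightarrow> real \<Rightarrow> (real \<Rightarrow> complex) \<Rightarrow> bool" where
  "L2_on a b f \<longleftrightarrow>
     f \<in> borel_measurable (lebesgue_on {a<..<b}) \<and>
     integrable (lebesgue_on {a<..<b}) (\<lambda>x. (cmod (f x))\<^sup>2)"

definition L2_norm :: "real \<Rightarrow> real \<Rightarrow> (real \<Rightarrow> complex) \<Rightarrow> real" where
  "L2_norm a b f = sqrt (LINT x|lebesgue_on {a<..<b}. (cmod (f x))\<^sup>2)"

text \<open>
  Continuously differentiable test functions with compact support in \<open>(a, b)\<close>, extended by zero.
  For square integrable functions they determine the same weak derivatives as infinitely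
  differentiable ones.
\<close>

definition test_function :: "real \<Rightarrow> real \<Rightarrow> (real \<Rightarrow> real) \<Rightarrow> bool" where
  "test_function a b \<phi> \<longleftrightarrow>
     \<phi> differentiable_on UNIV \<and> continuous_on UNIV (deriv \<phi>) \<and>
     (\<exists>c d. a < c \<and> d < b \<and> (\<forall>x. x \<notin> {c..d} \<longrightarrow> \<phi> x = 0))"

definition has_weak_derivative ::
    "real \<Rightarrow> real \<Rightarrow> (real \<Rightarrow> complex) \<Rightarrow> (real \<Rightarrow> complex) \<Rightarrow> bool" where
  "has_weak_derivative a b f g \<longleftrightarrow>
     L2_on a b f \<and> L2_on a b g \<and>
     (\<forall>\<phi>. test_function a b \<phi> \<longrightarrow>
        (LINT x|lebesgue_on {a<..<b}. f x * of_real (deriv \<phi> x)) =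
        - (LINT x|lebesgue_on {a<..<b}. g x * of_real (\<phi> x)))"

text \<open>The choice below is unique up to equality almost everywhere on \<open>(a, b)\<close>.\<close>

definition weak_deriv :: "real \<Rightarrow> real \<Rightarrow> (real \<Rightarrow> complex) \<Rightarrow> (real \<Rightarrow> complex)" where
  "weak_deriv a b f = (SOME g. has_weak_derivative a b f g)"

definition H1_on :: "real \<Rightarrow> real \<Rightarrow> (real \<Rightarrow> complex) \<Rightarrow> bool" where
  "H1_on a b f \<longleftrightarrow> (\<exists>g. has_weak_derivative a b f g)"

definition H2_on :: "real \<Rightarrow> real \<Rightarrow> (real \<Rightarrow> complex) \<Rightarrow> bool" where
  "H2_on a b f \<longleftrightarrow> H1_on a b f \<and> H1_on a b (weak_deriv a b f)"

text \<open>
  Value at \<open>c \<in> [a, b]\<close> of the representative of \<open>f\<close> that is continuous on \<open>[a, b]\<close>; it exists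
  and is unique for \<open>f\<close> in \<open>H\<^sup>1(a, b)\<close>.
\<close>

definition point_value :: "real \<Rightarrow> real \<Rightarrow> (real \<Rightarrow> complex) \<Rightarrow> real \<Rightarrow> complex" where
  "point_value a b f c =
     (THE z. \<exists>g. continuous_on {a..b} g \<and> (AE x in lebesgue_on {a<..<b}. f x = g x) \<and> g c = z)"


section \<open>Vertex conditions\<close>

definition cinner2 :: "complex ^ 2 \<Rightarrow> complex ^ 2 \<Rightarrow> complex" where
  "cinner2 x y = (\<Sum>i\<in>UNIV. x $ i * cnj (y $ i))"

definition orthogonal_projection :: "complex ^ 2 ^ 2 \<Rightarrow> bool" where
  "orthogonal_projection P \<longleftrightarrow>
     P ** P = P \<and> (\<forall>x y. cinner2 (P *v x) y = cinner2 x (P *v y))"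

text \<open>The values of \<open>T\<close> outside the subspace \<open>V\<close> are irrelevant.\<close>

definition selfadjoint_on :: "(complex ^ 2) set \<Rightarrow> (complex ^ 2 \<Rightarrow> complex ^ 2) \<Rightarrow> bool" where
  "selfadjoint_on V T \<longleftrightarrow>
     (\<forall>x\<in>V. T x \<in> V) \<and>
     (\<forall>x\<in>V. \<forall>y\<in>V. T (x + y) = T x + T y) \<and>
     (\<forall>c. \<forall>x\<in>V. T (c *s x) = c *s T x) \<and>
     (\<forall>x\<in>V. \<forall>y\<in>V. cinner2 (T x) y = cinner2 x (T y))"

definition complementary_projection :: "complex ^ 2 ^ 2 \<Rightarrow> complex ^ 2 ^ 2" where
  "complementary_projection P = mat 1 - P"

definition vertex_conditions :: "complex ^ 2 ^ 2 \<Rightarrow> (complex ^ 2 \<Rightarrow> complex ^ 2) \<Rightarrow> bool" where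
  "vertex_conditions P T \<longleftrightarrow>
     orthogonal_projection P \<and>
     selfadjoint_on (range (\<lambda>x. complementary_projection P *v x)) T"


section \<open>The operator on the metric graph\<close>

text \<open>
  A function on the graph is a pair: its first component lives on the short edge \<open>(0, \<epsilon>)\<close>, its
  second component on the edge \<open>(0, 1)\<close>.
\<close>

type_synonym graph_fun = "(real \<Rightarrow> complex) \<times> (real \<Rightarrow> complex)"

definition short_norm :: "real \<Rightarrow> graph_fun \<Rightarrow> real" where
  "short_norm \<epsilon> \<psi> = L2_norm 0 \<epsilon> (fst \<psi>)"

definition edge_norm :: "graph_fun \<Rightarrow> real" where
  "edge_norm \<psi> = L2_norm 0 1 (snd \<psi>)"

definition graph_norm :: "real \<Rightarrow> graph_fun \<Rightarrow> real" where
  "graph_norm \<epsilon> \<psi> = sqrt ((short_norm \<epsilon> \<psi>)\<^sup>2 + (edge_norm \<psi>)\<^sup>2)"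

definition graph_ae_eq :: "real \<Rightarrow> graph_fun \<Rightarrow> graph_fun \<Rightarrow> bool" where
  "graph_ae_eq \<epsilon> \<psi> \<phi> \<longleftrightarrow>
     (AE x in lebesgue_on {0<..<\<epsilon>}. fst \<psi> x = fst \<phi> x) \<and>
     (AE x in lebesgue_on {0<..<1}. snd \<psi> x = snd \<phi> x)"

definition vertex_values :: "real \<Rightarrow> graph_fun \<Rightarrow> complex ^ 2" where
  "vertex_values \<epsilon> \<psi> = vector [point_value 0 \<epsilon> (fst \<psi>) \<epsilon>, point_value 0 1 (snd \<psi>) 1]"

definition vertex_derivatives :: "real \<Rightarrow> graph_fun \<Rightarrow> complex ^ 2" where
  "vertex_derivatives \<epsilon> \<psi> =
     vector [- point_value 0 \<epsilon> (weak_deriv 0 \<epsilon> (fst \<psi>)) \<epsilon>,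
             - point_value 0 1 (weak_deriv 0 1 (snd \<psi>)) 1]"

definition H_domain ::
    "complex ^ 2 ^ 2 \<Rightarrow> (complex ^ 2 \<Rightarrow> complex ^ 2) \<Rightarrow> real \<Rightarrow> graph_fun set" where
  "H_domain P T \<epsilon> =
     {\<psi>. H2_on 0 \<epsilon> (fst \<psi>) \<and> H2_on 0 1 (snd \<psi>) \<and>
         point_value 0 \<epsilon> (weak_deriv 0 \<epsilon> (fst \<psi>)) 0 = 0 \<and>
         point_value 0 1 (snd \<psi>) 0 = 0 \<and>
         P *v vertex_values \<epsilon> \<psi> = 0 \<and>
         complementary_projection P *v vertex_derivatives \<epsilon> \<psi> =
           T (complementary_projection P *v vertex_values \<epsilon> \<psi>)}"

definition H_op :: "real \<Rightarrow> graph_fun \<Rightarrow> graph_fun" where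
  "H_op \<epsilon> \<psi> =
     (\<lambda>x. - weak_deriv 0 \<epsilon> (weak_deriv 0 \<epsilon> (fst \<psi>)) x,
      \<lambda>x. - weak_deriv 0 1 (weak_deriv 0 1 (snd \<psi>)) x)"

definition eigenfunction ::
    "complex ^ 2 ^ 2 \<Rightarrow> (complex ^ 2 \<Rightarrow> complex ^ 2) \<Rightarrow> real \<Rightarrow> real \<Rightarrow> graph_fun \<Rightarrow> bool" where
  "eigenfunction P T \<epsilon> \<mu> \<psi> \<longleftrightarrow>
     \<psi> \<in> H_domain P T \<epsilon> \<and>
     \<not> graph_ae_eq \<epsilon> \<psi> (\<lambda>x. 0, \<lambda>x. 0) \<and>
     graph_ae_eq \<epsilon> (H_op \<epsilon> \<psi>) (\<lambda>x. of_real \<mu> * fst \<psi> x, \<lambda>x. of_real \<mu> * snd \<psi> x)"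

definition eigenvalue ::
    "complex ^ 2 ^ 2 \<Rightarrow> (complex ^ 2 \<Rightarrow> complex ^ 2) \<Rightarrow> real \<Rightarrow> real \<Rightarrow> bool" where
  "eigenvalue P T \<epsilon> \<mu> \<longleftrightarrow> (\<exists>\<psi>. eigenfunction P T \<epsilon> \<mu> \<psi>)"

definition normalized_eigenfunction ::
    "complex ^ 2 ^ 2 \<Rightarrow> (complex ^ 2 \<Rightarrow> complex ^ 2) \<Rightarrow> real \<Rightarrow> real \<Rightarrow> graph_fun \<Rightarrow> bool" where
  "normalized_eigenfunction P T \<epsilon> \<mu> \<psi> \<longleftrightarrow> eigenfunction P T \<epsilon> \<mu> \<psi> \<and> graph_norm \<epsilon> \<psi> = 1"


section \<open>Types of negative eigenvalues\<close>

definition negative_eigenvalue ::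
    "complex ^ 2 ^ 2 \<Rightarrow> (complex ^ 2 \<Rightarrow> complex ^ 2) \<Rightarrow> (real \<Rightarrow> real) \<Rightarrow> bool" where
  "negative_eigenvalue P T \<mu> \<longleftrightarrow>
     (\<forall>\<^sub>F \<epsilon> in at_right 0. eigenvalue P T \<epsilon> (\<mu> \<epsilon>) \<and> \<mu> \<epsilon> < 0)"

definition smooth_on :: "real set \<Rightarrow> (real \<Rightarrow> complex) \<Rightarrow> bool" where
  "smooth_on S f \<longleftrightarrow>
     (\<exists>D. (\<forall>x\<in>S. D 0 x = f x) \<and>
          (\<forall>n::nat. \<forall>x\<in>S. (D n has_vector_derivative D (Suc n) x) (at x within S)))"

definition exponentially_small :: "(real \<Rightarrow> complex) \<Rightarrow> bool" where
  "exponentially_small \<Lambda>\<^sub>1 \<longleftrightarrow>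
     (\<exists>\<delta>>0. smooth_on {0<..<\<delta>} \<Lambda>\<^sub>1) \<and>
     (\<exists>C>0. (\<lambda>s. cmod (\<Lambda>\<^sub>1 s)) \<in> O[at_right 0](\<lambda>s. exp (- C / s)))"

definition type_B :: "(real \<Rightarrow> real) \<Rightarrow> bool" where
  "type_B \<mu> \<longleftrightarrow>
     (\<exists>\<Lambda>\<^sub>0 \<alpha>. \<Lambda>\<^sub>0 analytic_on {0} \<and> \<Lambda>\<^sub>0 0 \<noteq> 0 \<and> \<alpha> > 0 \<and>
        (\<forall>\<^sub>F \<epsilon> in at_right 0. complex_of_real (\<mu> \<epsilon>) = - (\<Lambda>\<^sub>0 (of_real \<epsilon>))\<^sup>2) \<and>
        (\<lambda>\<epsilon>. \<mu> \<epsilon> - (- \<alpha>)) \<in> O[at_right 0](\<lambda>\<epsilon>. \<epsilon>))"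

definition type_S :: "(real \<Rightarrow> real) \<Rightarrow> bool" where
  "type_S \<mu> \<longleftrightarrow>
     (\<exists>\<Lambda>\<^sub>0 \<Lambda>\<^sub>1 \<alpha>. \<Lambda>\<^sub>0 analytic_on {0} \<and> \<Lambda>\<^sub>0 0 \<noteq> 0 \<and> exponentially_small \<Lambda>\<^sub>1 \<and> \<alpha> > 0 \<and>
        (\<forall>\<^sub>F \<epsilon> in at_right 0. complex_of_real (\<mu> \<epsilon>) =
           - of_real (\<epsilon> powr (-1)) *
             (\<Lambda>\<^sub>0 (of_real (\<epsilon> powr (1/2))) + \<Lambda>\<^sub>1 (\<epsilon> powr (1/2)))\<^sup>2) \<and>
        (\<lambda>\<epsilon>. \<mu> \<epsilon> - (- \<alpha> * \<epsilon> powr (-1))) \<in> O[at_right 0](\<lambda>\<epsilon>. \<epsilon> powr (-1/2)))"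

definition type_C :: "(real \<Rightarrow> real) \<Rightarrow> bool" where
  "type_C \<mu> \<longleftrightarrow>
     (\<exists>\<Lambda>\<^sub>0 \<Lambda>\<^sub>1 \<alpha>. \<Lambda>\<^sub>0 analytic_on {0} \<and> \<Lambda>\<^sub>0 0 \<noteq> 0 \<and> exponentially_small \<Lambda>\<^sub>1 \<and> \<alpha> > 0 \<and>
        (\<forall>\<^sub>F \<epsilon> in at_right 0. complex_of_real (\<mu> \<epsilon>) =
           - of_real (\<epsilon> powr (-2/3)) *
             (\<Lambda>\<^sub>0 (of_real (\<epsilon> powr (1/3))) + \<Lambda>\<^sub>1 (\<epsilon> powr (1/3)))\<^sup>2) \<and>
        (\<lambda>\<epsilon>. \<mu> \<epsilon> - (- \<alpha> * \<epsilon> powr (-2/3))) \<in> O[at_right 0](\<lambda>\<epsilon>. \<epsilon> powr (-1/3)))"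

end

theory Submission
  imports Defs "HOL-Real_Asymp.Real_Asymp"
begin

text \<open>
  Let \<open>\<mu> = - \<kappa>\<^sup>2\<close> with \<open>\<kappa> > 0\<close>. The boundary conditions at the outer end points force an eigenfunction to be a
  multiple of \<open>cosh (\<kappa> x)\<close> on the short edge and of \<open>sinh (\<kappa> x)\<close> on the edge \<open>(0, 1)\<close>. If \<open>y\<close> and \<open>z\<close> are its
  values at the central vertex, then \<open>U' = (- d\<^sub>1 y, - d\<^sub>2 z)\<close> with \<open>d\<^sub>1 = \<kappa> tanh (\<kappa> \<epsilon>)\<close> and \<open>d\<^sub>2 = \<kappa> / tanh \<kappa>\<close>, and
  the squared norms over the two edges are \<open>\<bar>y\<bar>\<^sup>2\<close> and \<open>\<bar>z\<bar>\<^sup>2\<close> times explicit weights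
  (\<open>eigenfunction_vertex_form\<close>). The weight of the short edge behaves like \<open>\<epsilon>\<close> when \<open>\<kappa> \<epsilon>\<close> is small; the weight
  of the long edge is a function of \<open>\<kappa>\<close> alone and behaves like \<open>1 / (2 \<kappa>)\<close> when \<open>\<kappa>\<close> is large.
  
  As the eigenfunctions are Sobolev functions given up to null sets, the explicit form has to be
  derived from the weak equation. Here \<open>u' + \<kappa> u\<close> and \<open>u' - \<kappa> u\<close> solve first order equations, and
  these reduce by an integrating factor to the lemma of du Bois-Reymond
  (\<open>du_Bois_Reymond\<close>, \<open>weak_ode_solution\<close>).
  
  A vertex condition either is a Hermitian system \<open>U' = T U\<close>, that is
  \<open>(t + d\<^sub>1) y = - b z\<close> and \<open>(s + d\<^sub>2) z = - cnj b y\<close>, or it confines \<open>(y, z)\<close> to the multiples of a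
  fixed vector and adds one scalar equation for \<open>\<kappa>\<close> (\<open>vertex_conditions_cases\<close>). What remains is to compare
  sizes, and for this only the order of magnitude of \<open>\<kappa>\<close> matters.
  
  Type (B), \<open>\<kappa>\<close> of order \<open>1\<close>: the vertex equations bound \<open>y\<close> by a multiple of \<open>z\<close>, so the short edge carries
  \<open>O(\<epsilon>)\<close> because of its weight (\<open>bounded_wave_number\<close>). Type (S), \<open>\<kappa>\<close> of order \<open>\<epsilon>\<close> to the power \<open>-1/2\<close>:
  since \<open>d\<^sub>2\<close> is large, \<open>z\<close> is \<open>O(y / \<kappa>)\<close>, and the long edge carries \<open>O(1 / (\<kappa>\<^sup>3 \<epsilon>))\<close>
  (\<open>wave_number_of_order_half\<close>). Type (C), \<open>\<kappa>\<close> of order \<open>\<epsilon>\<close> to the power \<open>-1/3\<close>: both contributions have the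
  same order. The determinant of the vertex equations vanishes, which forces \<open>t = 0\<close> and
  \<open>d\<^sub>1 (s + d\<^sub>2) = \<bar>b\<bar>\<^sup>2\<close>; with it the ratio of the squared norms no longer involves \<open>b\<close> and tends to \<open>1/2\<close>
  (\<open>wave_number_of_order_third\<close>).
\<close>

section \<open>The du Bois-Reymond lemma\<close>

text \<open>
  The integral over a Borel set vanishes by a Dynkin argument: half-lines \<open>{s<..}\<close> are stable under
  intersection and generate the Borel sets. A Lebesgue measurable set differs from a Borel set by a
  null set, so the integral vanishes over every measurable set.
\<close>

lemma AE_zero_if_integral_zero_right_segments:
  fixes f :: "real \<Rightarrow> 'b :: {banach, second_countable_topology}"
  assumes f: "integrable (lebesgue_on {a<..<b}) f"
    and seg: "\<And>s. a \<le> s \<Longrightarrow> s < b \<Longrightarrow>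
      (LINT x|lebesgue_on {a<..<b}. indicator {s<..<b} x *\<^sub>R f x) = 0"
  shows "AE x in lebesgue_on {a<..<b}. f x = 0"
proof (cases "a < b")
  case False
  then have "{a<..<b} = {}" by auto
  then show ?thesis by (simp add: AE_restrict_space_iff)
next
  case True
  let ?M = "lebesgue_on {a<..<b}"
  interpret finite_measure ?M
    by (rule finite_measure_lebesgue_on) auto
  have borel_M: "B \<inter> {a<..<b} \<in> sets ?M" if "B \<in> sets borel" for B
    using that by (auto simp: sets_restrict_space)
  have int_ind: "integrable ?M (\<lambda>x. indicator B x *\<^sub>R f x)" if "B \<in> sets borel" for B
  proof -
    have "integrable ?M (\<lambda>x. indicator (B \<inter> {a<..<b}) x *\<^sub>R f x)"
      by (rule integrable_mult_indicator[OF borel_M[OF that] f])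
    then show ?thesis
      by (rule Bochner_Integration.integrable_cong[THEN iffD1, rotated -1])
         (auto simp: indicator_def)
  qed
  have right: "(LINT x|?M. indicator {s<..} x *\<^sub>R f x) = 0" for s
  proof (cases "s < b")
    case True
    have "(LINT x|?M. indicator {s<..} x *\<^sub>R f x)
        = (LINT x|?M. indicator {max a s<..<b} x *\<^sub>R f x)"
      by (rule Bochner_Integration.integral_cong) (auto simp: indicator_def)
    also have "\<dots> = 0"
      using True \<open>a < b\<close> by (intro seg) auto
    finally show ?thesis .
  next
    case False
    have "(LINT x|?M. indicator {s<..} x *\<^sub>R f x) = (LINT x|?M. 0)"
      using False by (intro Bochner_Integration.integral_cong) (auto simp: indicator_def)
    then show ?thesis by simp
  qed
  have total: "(LINT x|?M. f x) = 0"
  proof -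
    have "(LINT x|?M. f x) = (LINT x|?M. indicator {a<..} x *\<^sub>R f x)"
      by (rule Bochner_Integration.integral_cong) (auto simp: indicator_def)
    then show ?thesis using right by simp
  qed
  have borel0: "(LINT x|?M. indicator B x *\<^sub>R f x) = 0" if "B \<in> sets borel" for B
  proof -
    have "Int_stable (range (greaterThan :: real \<Rightarrow> real set))"
    proof -
      have "{x<..} \<inter> {y<..} = {max x y<..}" for x y :: real by auto
      then show ?thesis unfolding Int_stable_def by blast
    qed
    moreover have "range (greaterThan :: real \<Rightarrow> real set) \<subseteq> Pow UNIV"
      by simp
    moreover have "B \<in> sigma_sets UNIV (range greaterThan)"
      using that by (simp add: borel_Ioi)
    ultimately show ?thesis
    proof (induction rule: sigma_sets_induct_disjoint)
      case (basic A)
      then show ?case using right by auto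
    next
      case (compl A)
      then have A: "A \<in> sets borel" by (simp add: borel_Ioi)
      have "(LINT x|?M. indicator (UNIV - A) x *\<^sub>R f x)
          = (LINT x|?M. f x - indicator A x *\<^sub>R f x)"
        by (rule Bochner_Integration.integral_cong) (auto simp: indicator_def)
      also have "\<dots> = 0"
        using total compl by (simp add: Bochner_Integration.integral_diff[OF f int_ind[OF A]])
      finally show ?case .
    next
      case (union A)
      then have A: "A i \<in> sets borel" for i by (auto simp: borel_Ioi)
      have A': "A i \<inter> {a<..<b} \<in> sets ?M" for i by (rule borel_M[OF A])
      have disj: "A i \<inter> {a<..<b} \<inter> (A j \<inter> {a<..<b}) = {}" if "i \<noteq> j" for i j
        using union(1) that by (auto simp: disjoint_family_on_def)
      have U: "(\<Union>i. A i) \<in> sets borel" using A by auto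
      have restr: "(LINT x|?M. indicator (B \<inter> {a<..<b}) x *\<^sub>R f x) = (LINT x|?M. indicator B x *\<^sub>R f x)" for B
        by (rule Bochner_Integration.integral_cong) (auto simp: indicator_def)
      have "set_lebesgue_integral ?M (\<Union>i. A i \<inter> {a<..<b}) f
          = (\<Sum>i. set_lebesgue_integral ?M (A i \<inter> {a<..<b}) f)"
        using int_ind[OF U] disj
        by (intro lebesgue_integral_countable_add A')
           (auto simp: set_integrable_def intro!: integrable_mult_indicator f sets.countable_UN A'
              simp del: UN_simps)
      also have "\<dots> = 0"
        using union(3) by (simp add: set_lebesgue_integral_def restr)
      also have "(\<Union>i. A i \<inter> {a<..<b}) = (\<Union>i. A i) \<inter> {a<..<b}" by auto
      finally show ?case by (simp only: set_lebesgue_integral_def restr)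
    qed auto
  qed
  show ?thesis
  proof (rule density_zero[OF f])
    fix A assume "A \<in> sets ?M"
    then have "A \<in> sets lebesgue"
      by (auto simp: sets_restrict_space_iff)
    then obtain S N N' where A: "A = S \<union> N" "N \<subseteq> N'" "N' \<in> null_sets lborel" "S \<in> sets lborel"
      by (rule sets_completionE)
    have S: "S \<in> sets borel" using A by simp
    have "AE x in lebesgue. x \<notin> N'"
      using A(3) by (intro AE_not_in null_sets_completionI)
    then have "AE x in ?M. x \<notin> N'"
      by (subst AE_restrict_space_iff) auto
    then have ae: "AE x in ?M. indicator A x *\<^sub>R f x = indicator S x *\<^sub>R f x"
      by eventually_elim (use A in \<open>auto simp: indicator_def\<close>)
    have "(LINT x|?M. indicator A x *\<^sub>R f x) = (LINT x|?M. indicator S x *\<^sub>R f x)"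
      using \<open>A \<in> sets ?M\<close> int_ind[OF S] f
      by (intro integral_cong_AE ae borel_measurable_integrable) (auto intro: integrable_mult_indicator)
    then show "set_lebesgue_integral ?M A f = 0"
      by (simp add: set_lebesgue_integral_def borel0[OF S])
  qed
qed


lemma continuous_imp_integrable_lebesgue_on_Ioo:
  fixes g :: "real \<Rightarrow> 'b::euclidean_space"
  assumes "continuous_on {a..b} g"
  shows "integrable (lebesgue_on {a<..<b}) g"
proof -
  have "set_integrable lebesgue {a..b} g"
    using assms by (rule absolutely_integrable_continuous_real)
  then have "set_integrable lebesgue {a<..<b} g"
    by (rule set_integrable_subset) auto
  then show ?thesis
    by (simp add: integrable_restrict_space set_integrable_def)
qed

lemma integral_lebesgue_on_Ioo_FTC:
  fixes g :: "real \<Rightarrow> 'b::euclidean_space"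
  assumes "a \<le> b" and g: "continuous_on {a..b} g"
    and G: "\<And>x. x \<in> {a..b} \<Longrightarrow> (G has_vector_derivative g x) (at x within {a..b})"
  shows "(LINT x|lebesgue_on {a<..<b}. g x) = G b - G a"
proof -
  have "(LINT x|lebesgue_on {a<..<b}. g x) = integral {a<..<b} g"
    by (intro lebesgue_integral_eq_integral continuous_imp_integrable_lebesgue_on_Ioo g) auto
  also have "\<dots> = integral {a..b} g"
    by (simp add: integral_open_interval_real)
  also have "\<dots> = G b - G a"
    by (rule integral_unique[OF fundamental_theorem_of_calculus[OF \<open>a \<le> b\<close> G]])
  finally show ?thesis .
qed

lemma integrable_mult_continuous_Ioo:
  fixes f :: "real \<Rightarrow> complex"
  assumes f: "integrable (lebesgue_on {a<..<b}) f" and g: "continuous_on {a..b} g"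
  shows "integrable (lebesgue_on {a<..<b}) (\<lambda>x. f x * complex_of_real (g x))"
proof -
  have "bounded (g ` {a..b})"
    using g by (intro compact_imp_bounded compact_continuous_image) auto
  then obtain C where C: "\<And>x. x \<in> {a..b} \<Longrightarrow> \<bar>g x\<bar> \<le> C"
    unfolding bounded_iff by (metis image_eqI real_norm_def)
  have [measurable]: "g \<in> borel_measurable (lebesgue_on {a<..<b})"
    by (intro continuous_imp_measurable_on_sets_lebesgue continuous_on_subset[OF g]) auto
  have [measurable]: "f \<in> borel_measurable (lebesgue_on {a<..<b})"
    using f by (rule borel_measurable_integrable)
  show ?thesis
  proof (rule Bochner_Integration.integrable_bound)
    show "integrable (lebesgue_on {a<..<b}) (\<lambda>x. f x * complex_of_real C)"
      using f by simp
    show "AE x in lebesgue_on {a<..<b}. norm (f x * complex_of_real (g x)) \<le> norm (f x * complex_of_real C)"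
    proof (rule AE_I2)
      fix x assume "x \<in> space (lebesgue_on {a<..<b})"
      then have "\<bar>g x\<bar> \<le> \<bar>C\<bar>" using C[of x] by auto
      then show "norm (f x * complex_of_real (g x)) \<le> norm (f x * complex_of_real C)"
        by (simp add: norm_mult mult_left_mono)
    qed
  qed measurable
qed

lemma L2_on_imp_integrable:
  assumes "L2_on a b f"
  shows "integrable (lebesgue_on {a<..<b}) f"
proof (rule Bochner_Integration.integrable_bound)
  interpret finite_measure "lebesgue_on {a<..<b}"
    by (rule finite_measure_lebesgue_on) auto
  show "integrable (lebesgue_on {a<..<b}) (\<lambda>x. 1 + (cmod (f x))\<^sup>2)"
    using assms by (auto simp: L2_on_def)
  have "cmod z \<le> 1 + (cmod z)\<^sup>2" for z
    using zero_le_power2[of "cmod z - 1/2"] by (simp add: power2_eq_square algebra_simps)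
  then show "AE x in lebesgue_on {a<..<b}. norm (f x) \<le> norm (1 + (cmod (f x))\<^sup>2)"
    by (intro AE_I2) (metis abs_ge_self order_trans real_norm_def)
qed (use assms in \<open>auto simp: L2_on_def\<close>)

text \<open>
  The vanishing mean is what makes an antiderivative that is zero to the left of the support of
  \<open>\<psi>\<close> return to zero on its right.
\<close>

lemma test_function_antiderivative:
  assumes \<psi>: "continuous_on UNIV \<psi>" and "a < c" "c \<le> d" "d < b"
    and supp: "\<And>x. x \<notin> {c..d} \<Longrightarrow> \<psi> x = (0::real)"
    and mean: "(LINT x|lebesgue_on {a<..<b}. \<psi> x) = 0"
  obtains \<phi> where "test_function a b \<phi>" "deriv \<phi> = \<psi>"
proof -
  have "\<exists>F. \<forall>x::real. -\<infinity> < ereal x \<longrightarrow> ereal x < \<infinity> \<longrightarrow> (F has_vector_derivative \<psi> x) (at x)"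
    using \<psi> by (intro einterval_antiderivative) (auto simp: continuous_on_eq_continuous_at)
  then obtain F where F: "\<And>x. (F has_real_derivative \<psi> x) (at x)"
    unfolding has_real_derivative_iff_has_vector_derivative by auto
  have contF: "continuous_on A F" for A
    using F by (meson DERIV_continuous_on has_field_derivative_at_within)
  have left: "F x = F c" if "x \<le> c" for x
  proof (cases "x = c")
    case False
    have "(F has_real_derivative 0) (at y)" if "y < c" for y
      using F[of y] supp[of y] that by simp
    then show ?thesis
      using False that by (intro DERIV_isconst_end[symmetric] contF) auto
  qed simp
  have right: "F x = F d" if "d \<le> x" for x
  proof (cases "x = d")
    case False
    have "(F has_real_derivative 0) (at y)" if "d < y" for y
      using F[of y] supp[of y] that by simp
    then show ?thesis
      using False that by (intro DERIV_isconst_end contF) auto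
  qed simp
  have "F b - F a = 0"
    unfolding mean[symmetric] using F assms
    by (intro integral_lebesgue_on_Ioo_FTC[symmetric] continuous_on_subset[OF \<psi>])
       (auto simp: has_real_derivative_iff_has_vector_derivative intro: has_vector_derivative_at_within)
  then have "F c = F d"
    using left[of a] right[of b] assms by simp
  define \<phi> where "\<phi> x = F x - F c" for x
  have \<phi>: "(\<phi> has_real_derivative \<psi> x) (at x)" for x
    unfolding \<phi>_def using F[of x] by (auto intro!: derivative_eq_intros)
  then have deriv: "deriv \<phi> = \<psi>"
    by (intro ext DERIV_imp_deriv)
  have "\<phi> differentiable_on UNIV"
    using \<phi> by (auto simp: differentiable_on_def intro: real_differentiable_def[THEN iffD2] differentiable_at_withinI)
  moreover have "\<phi> x = 0" if "x \<notin> {c..d}" for x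
    using that left[of x] right[of x] \<open>F c = F d\<close> by (auto simp: \<phi>_def)
  ultimately have "test_function a b \<phi>"
    unfolding test_function_def using deriv \<psi> assms by auto
  then show thesis using deriv that by blast
qed

text \<open>
  By \<open>test_function_antiderivative\<close>, \<open>f\<close> annihilates every continuous \<open>\<eta>\<close> of mean zero with compact
  support in \<open>(a, b)\<close>. Hence \<open>\<integral> f t = c \<integral> t\<close> for all continuous \<open>t\<close> with compact support, with one
  constant \<open>c\<close>. Letting \<open>t\<close> run through a sequence of trapezoids that converges boundedly to the
  indicator function of a segment \<open>(s, b)\<close> shows that the integral of \<open>f - c\<close> over each such
  segment vanishes.
\<close>

lemma du_Bois_Reymond:
  fixes f :: "real \<Rightarrow> complex"
  assumes "a < b" and f: "integrable (lebesgue_on {a<..<b}) f"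
    and orth: "\<And>\<phi>. test_function a b \<phi> \<Longrightarrow>
      (LINT x|lebesgue_on {a<..<b}. f x * of_real (deriv \<phi> x)) = 0"
  shows "\<exists>c. AE x in lebesgue_on {a<..<b}. f x = c"
proof -
  let ?M = "lebesgue_on {a<..<b}"
  interpret finite_measure ?M
    by (rule finite_measure_lebesgue_on) auto
  \<comment> \<open>Trapezoids: subtracting 1 before cutting off at 0 keeps the support at distance at least
    \<open>1 / Suc n\<close> from both end points, so it is compact in \<open>(a, b)\<close> even when \<open>s = a\<close>.\<close>
  define t where "t s n x = max 0 (min 1 (real (Suc n) * min (x - s) (b - x) - 1))" for s n x
  define L where "L s n = (LINT x|?M. t s n x)" for s n
  have cont: "continuous_on A (t s n)" for A s n
    unfolding t_def by (intro continuous_intros)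
  have bound: "0 \<le> t s n x" "t s n x \<le> 1" for s n x
    by (auto simp: t_def)
  have supp: "t s n x = 0" if "x - s \<le> 1 / real (Suc n) \<or> b - x \<le> 1 / real (Suc n)" for s n x
  proof -
    have "min (x - s) (b - x) \<le> 1 / real (Suc n)" using that by auto
    then have "real (Suc n) * min (x - s) (b - x) \<le> 1"
      by (simp add: pos_le_divide_eq mult.commute del: of_nat_Suc)
    then show ?thesis by (simp add: t_def del: of_nat_Suc)
  qed
  have tendsto: "(\<lambda>n. t s n x) \<longlonglongrightarrow> indicator {s<..<b} x" for s x
  proof (cases "x \<in> {s<..<b}")
    case True
    define m where "m = min (x - s) (b - x)"
    have "m > 0" using True by (auto simp: m_def)
    have "\<forall>\<^sub>F n in sequentially. 2 / m \<le> real n"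
      by (intro eventually_sequentiallyI[of "nat \<lceil>2 / m\<rceil>"]) linarith
    then have "\<forall>\<^sub>F n in sequentially. t s n x = indicator {s<..<b} x"
    proof eventually_elim
      case (elim n)
      then have "2 \<le> real n * m" using \<open>m > 0\<close> by (simp add: field_simps)
      also have "\<dots> \<le> real (Suc n) * m" using \<open>m > 0\<close> by simp
      finally show ?case using True by (simp add: t_def m_def[symmetric] del: of_nat_Suc)
    qed
    then show ?thesis by (rule tendsto_eventually)
  next
    case False
    then have "x - s \<le> 0 \<or> b - x \<le> 0" by auto
    moreover have "0 \<le> 1 / real (Suc n)" for n by simp
    ultimately have "x - s \<le> 1 / real (Suc n) \<or> b - x \<le> 1 / real (Suc n)" for n
      by (meson order_trans)
    then have "t s n x = 0" for n by (rule supp)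
    then show ?thesis using False by simp
  qed
  have lim: "(\<lambda>n. LINT x|?M. g x * of_real (t s n x)) \<longlonglongrightarrow> (LINT x|?M. indicator {s<..<b} x *\<^sub>R g x)"
    if g: "integrable ?M g" for g :: "real \<Rightarrow> complex" and s
  proof (rule integral_dominated_convergence)
    have [measurable]: "g \<in> borel_measurable ?M" using g by (rule borel_measurable_integrable)
    have [measurable]: "(t s n) \<in> borel_measurable ?M" for n
      by (intro continuous_imp_measurable_on_sets_lebesgue cont) auto
    have [measurable]: "{s<..<b} \<inter> {a<..<b} \<in> sets ?M"
      by (auto simp: sets_restrict_space)
    show "(\<lambda>x. g x * of_real (t s n x)) \<in> borel_measurable ?M" for n by measurable
    show "(\<lambda>x. indicator {s<..<b} x *\<^sub>R g x) \<in> borel_measurable ?M"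
    proof (rule measurable_cong[THEN iffD1])
      show "(\<lambda>x. indicat_real ({s<..<b} \<inter> {a<..<b}) x *\<^sub>R g x) \<in> borel_measurable ?M" by measurable
    qed (auto simp: indicator_def)
    show "integrable ?M (\<lambda>x. norm (g x))" using g by simp
    show "AE x in ?M. (\<lambda>n. g x * of_real (t s n x)) \<longlonglongrightarrow> indicator {s<..<b} x *\<^sub>R g x"
    proof (rule AE_I2)
      fix x
      have "(\<lambda>n. g x * complex_of_real (t s n x)) \<longlonglongrightarrow> g x * complex_of_real (indicator {s<..<b} x)"
        by (intro tendsto_intros tendsto)
      then show "(\<lambda>n. g x * of_real (t s n x)) \<longlonglongrightarrow> indicator {s<..<b} x *\<^sub>R g x"
        by (simp add: scaleR_conv_of_real mult.commute)
    qed
    show "AE x in ?M. norm (g x * of_real (t s n x)) \<le> norm (g x)" for n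
      using bound by (intro AE_I2) (simp add: norm_mult mult_left_le)
  qed
  have int_t: "integrable ?M (t s n)" for s n
    by (intro continuous_imp_integrable_lebesgue_on_Ioo cont)
  have int_gt: "integrable ?M (\<lambda>x. g x * of_real (t s n x))" if "integrable ?M g"
    for g :: "real \<Rightarrow> complex" and s n
    by (intro integrable_mult_continuous_Ioo that cont)
  \<comment> \<open>The integrals \<open>L a n\<close> tend to \<open>b - a\<close>, so one of them can serve for normalisation.\<close>
  obtain n0 where n0: "L a n0 \<noteq> 0"
  proof (rule ccontr)
    assume "\<not> thesis"
    then have "L a n = 0" for n using that by blast
    then have "(LINT x|?M. 1 * complex_of_real (t a n x)) = 0" for n
      by (simp add: L_def)
    then have "(LINT x|?M. indicator {a<..<b} x *\<^sub>R (1::complex)) = 0"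
      using lim[of "\<lambda>_. 1" a] by (simp add: LIMSEQ_const_iff)
    also have "(LINT x|?M. indicator {a<..<b} x *\<^sub>R (1::complex)) = (LINT x|?M. 1)"
      by (intro Bochner_Integration.integral_cong) auto
    also have "\<dots> = of_real (b - a)"
      using \<open>a < b\<close> by (simp add: measure_restrict_space scaleR_conv_of_real)
    finally show False using \<open>a < b\<close> by simp
  qed
  define c where "c = (LINT x|?M. f x * of_real (t a n0 x)) / of_real (L a n0)"
  have proportional: "(LINT x|?M. f x * of_real (t s n x)) = c * of_real (L s n)" if "a \<le> s" for s n
  proof -
    \<comment> \<open>The combination of the two trapezoids that has mean zero.\<close>
    define \<eta> where "\<eta> x = L a n0 * t s n x - L s n * t a n0 x" for x
    define e where "e = min (1 / real (Suc n)) (min (1 / real (Suc n0)) ((b - a) / 2))"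
    have e: "e > 0" "e \<le> 1 / real (Suc n)" "e \<le> 1 / real (Suc n0)" "e \<le> (b - a) / 2"
      using \<open>a < b\<close> unfolding e_def min_le_iff_disj by auto
    have mean: "(LINT x|?M. \<eta> x) = 0"
      unfolding \<eta>_def by (simp add: int_t L_def)
    obtain \<phi> where "test_function a b \<phi>" "deriv \<phi> = \<eta>"
    proof (rule test_function_antiderivative[OF _ _ _ _ _ mean, of "a + e" "b - e"])
      show "continuous_on UNIV \<eta>" unfolding \<eta>_def by (intro continuous_intros cont)
      show "a < a + e" "a + e \<le> b - e" "b - e < b" using e by (auto simp: field_simps)
      show "\<eta> x = 0" if "x \<notin> {a + e..b - e}" for x
      proof -
        have "x - s \<le> e \<or> b - x \<le> e" "x - a \<le> e \<or> b - x \<le> e" using that \<open>a \<le> s\<close> by auto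
        then have "t s n x = 0" "t a n0 x = 0"
          using e(2,3) by (intro supp; linarith)+
        then show ?thesis by (simp add: \<eta>_def)
      qed
    qed
    then have "0 = (LINT x|?M. f x * of_real (\<eta> x))" using orth[of \<phi>] by simp
    also have "\<dots> = (LINT x|?M. of_real (L a n0) * (f x * of_real (t s n x)) - of_real (L s n) * (f x * of_real (t a n0 x)))"
      by (intro Bochner_Integration.integral_cong) (auto simp: \<eta>_def algebra_simps)
    also have "\<dots> = of_real (L a n0) * (LINT x|?M. f x * of_real (t s n x)) - of_real (L s n) * (LINT x|?M. f x * of_real (t a n0 x))"
      by (subst Bochner_Integration.integral_diff) (auto intro!: int_gt f)
    finally show ?thesis using n0 by (simp add: c_def field_simps)
  qed
  have int_fc: "integrable ?M (\<lambda>x. f x - c)" using f by simp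
  have "AE x in ?M. f x - c = 0"
  proof (rule AE_zero_if_integral_zero_right_segments[OF int_fc])
    fix s assume "a \<le> s"
    have "(LINT x|?M. (f x - c) * of_real (t s n x)) = 0" for n
    proof -
      have "(LINT x|?M. (f x - c) * of_real (t s n x)) = (LINT x|?M. f x * of_real (t s n x) - c * of_real (t s n x))"
        by (simp add: algebra_simps)
      also have "\<dots> = (LINT x|?M. f x * of_real (t s n x)) - (LINT x|?M. c * of_real (t s n x))"
        by (intro Bochner_Integration.integral_diff int_gt f) auto
      also have "\<dots> = 0" by (simp add: proportional[OF \<open>a \<le> s\<close>] L_def)
      finally show ?thesis .
    qed
    then show "(LINT x|?M. indicator {s<..<b} x *\<^sub>R (f x - c)) = 0"
      using lim[OF int_fc, of s] by (simp add: LIMSEQ_const_iff)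
  qed
  then show ?thesis by auto
qed

section \<open>Weak solutions of a second order equation\<close>

lemma test_function_has_derivative:
  assumes "test_function a b \<phi>"
  shows "(\<phi> has_real_derivative deriv \<phi> x) (at x)"
  using assms unfolding test_function_def differentiable_on_def
  by (auto simp: DERIV_deriv_iff_real_differentiable)

lemma test_function_continuous:
  assumes "test_function a b \<phi>"
  shows "continuous_on A \<phi>" "continuous_on A (deriv \<phi>)"
proof -
  have "continuous_on UNIV \<phi>" "continuous_on UNIV (deriv \<phi>)"
    using assms by (auto simp: test_function_def differentiable_imp_continuous_on)
  then show "continuous_on A \<phi>" "continuous_on A (deriv \<phi>)"
    by (auto intro: continuous_on_subset)
qed

text \<open>
  The weak form of \<open>p' = \<sigma> p\<close> says that \<open>p\<close> times \<open>exp (- \<sigma> x)\<close> has weak derivative zero: the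
  integrating factor is moved onto the test function, which stays a test function.
\<close>

lemma weak_exponential:
  fixes p :: "real \<Rightarrow> complex"
  assumes "a < b" and p: "integrable (lebesgue_on {a<..<b}) p"
    and weak: "\<And>\<phi>. test_function a b \<phi> \<Longrightarrow>
      (LINT x|lebesgue_on {a<..<b}. p x * of_real (deriv \<phi> x)) =
      - of_real \<sigma> * (LINT x|lebesgue_on {a<..<b}. p x * of_real (\<phi> x))"
  shows "\<exists>A. AE x in lebesgue_on {a<..<b}. p x = A * of_real (exp (\<sigma> * x))"
proof -
  let ?M = "lebesgue_on {a<..<b}"
  let ?f = "\<lambda>x. p x * complex_of_real (exp (- \<sigma> * x))"
  have "\<exists>c. AE x in ?M. ?f x = c"
  proof (rule du_Bois_Reymond[OF \<open>a < b\<close>])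
    show "integrable ?M ?f"
      by (intro integrable_mult_continuous_Ioo p continuous_intros)
  next
    fix \<phi> assume \<phi>: "test_function a b \<phi>"
    note [continuous_intros] = test_function_continuous[OF \<phi>]
    define \<eta> where "\<eta> x = \<phi> x * exp (- \<sigma> * x)" for x
    have \<eta>': "(\<eta> has_real_derivative (deriv \<phi> x * exp (- \<sigma> * x) - \<sigma> * \<eta> x)) (at x)" for x
      unfolding \<eta>_def
      by (auto intro!: derivative_eq_intros test_function_has_derivative[OF \<phi>])
    then have deriv: "deriv \<eta> = (\<lambda>x. deriv \<phi> x * exp (- \<sigma> * x) - \<sigma> * \<eta> x)"
      by (intro ext DERIV_imp_deriv)
    have "test_function a b \<eta>"
      unfolding test_function_def
    proof (intro conjI)
      show "\<eta> differentiable_on UNIV"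
        using \<eta>' by (auto simp: differentiable_on_def intro: real_differentiable_def[THEN iffD2] differentiable_at_withinI)
      show "continuous_on UNIV (deriv \<eta>)"
        unfolding deriv \<eta>_def by (intro continuous_intros)
      show "\<exists>c d. a < c \<and> d < b \<and> (\<forall>x. x \<notin> {c..d} \<longrightarrow> \<eta> x = 0)"
        using \<phi> unfolding test_function_def \<eta>_def by auto
    qed
    then have *: "(LINT x|?M. p x * of_real (deriv \<eta> x)) = - of_real \<sigma> * (LINT x|?M. p x * of_real (\<eta> x))"
      by (rule weak)
    have "(LINT x|?M. p x * of_real (deriv \<eta> x))
        = (LINT x|?M. p x * of_real (deriv \<phi> x * exp (- \<sigma> * x)) - of_real \<sigma> * (p x * of_real (\<eta> x)))"
      unfolding deriv by (simp add: algebra_simps)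
    also have "\<dots> = (LINT x|?M. p x * of_real (deriv \<phi> x * exp (- \<sigma> * x))) - (LINT x|?M. of_real \<sigma> * (p x * of_real (\<eta> x)))"
      by (intro Bochner_Integration.integral_diff integrable_mult_right integrable_mult_continuous_Ioo p)
         (auto simp: \<eta>_def intro!: continuous_intros)
    finally have "(LINT x|?M. p x * of_real (deriv \<phi> x * exp (- \<sigma> * x))) = 0"
      using * by simp
    then show "(LINT x|?M. ?f x * of_real (deriv \<phi> x)) = 0"
      by (simp add: algebra_simps)
  qed
  then obtain c where "AE x in ?M. ?f x = c" ..
  then have "AE x in ?M. p x = c * of_real (exp (\<sigma> * x))"
    by eventually_elim (simp add: exp_minus field_simps)
  then show ?thesis ..
qed

text \<open>
  Factorisation of \<open>D\<^sup>2 - \<sigma>\<^sup>2\<close> as \<open>(D - \<sigma>) (D + \<sigma>)\<close>: the function \<open>u' + \<sigma> u\<close> solves a first order equation.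
\<close>

lemma weak_factor:
  assumes "a < b" and uv: "has_weak_derivative a b u v" and vw: "has_weak_derivative a b v w"
    and ode: "AE x in lebesgue_on {a<..<b}. w x = of_real (\<sigma>\<^sup>2) * u x"
  shows "\<exists>A. AE x in lebesgue_on {a<..<b}. v x + of_real \<sigma> * u x = A * of_real (exp (\<sigma> * x))"
proof (rule weak_exponential[OF \<open>a < b\<close>])
  let ?M = "lebesgue_on {a<..<b}"
  have u: "integrable ?M u" and v: "integrable ?M v" and w: "integrable ?M w"
    using uv vw by (auto simp: has_weak_derivative_def intro: L2_on_imp_integrable)
  show "integrable ?M (\<lambda>x. v x + of_real \<sigma> * u x)"
    using u v by simp
  fix \<phi> assume \<phi>: "test_function a b \<phi>"
  note int = integrable_mult_continuous_Ioo[OF _ test_function_continuous(1)[OF \<phi>]]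
    integrable_mult_continuous_Ioo[OF _ test_function_continuous(2)[OF \<phi>]]
  have split: "(LINT x|?M. (v x + of_real \<sigma> * u x) * of_real (g x))
      = (LINT x|?M. v x * of_real (g x)) + of_real \<sigma> * (LINT x|?M. u x * of_real (g x))"
    if "continuous_on {a..b} g" for g
  proof -
    have "(LINT x|?M. (v x + of_real \<sigma> * u x) * of_real (g x))
      = (LINT x|?M. v x * of_real (g x) + of_real \<sigma> * (u x * of_real (g x)))"
      by (simp add: algebra_simps)
    also have "\<dots> = (LINT x|?M. v x * of_real (g x)) + (LINT x|?M. of_real \<sigma> * (u x * of_real (g x)))"
      by (intro Bochner_Integration.integral_add integrable_mult_right integrable_mult_continuous_Ioo u v that)
    finally show ?thesis by simp
  qed
  have "(LINT x|?M. w x * of_real (\<phi> x)) = (LINT x|?M. of_real (\<sigma>\<^sup>2) * (u x * of_real (\<phi> x)))"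
  proof (rule integral_cong_AE)
    show "(\<lambda>x. w x * of_real (\<phi> x)) \<in> borel_measurable ?M"
      by (intro borel_measurable_integrable int w)
    show "(\<lambda>x. of_real (\<sigma>\<^sup>2) * (u x * of_real (\<phi> x))) \<in> borel_measurable ?M"
      by (intro borel_measurable_integrable integrable_mult_right int u)
    show "AE x in ?M. w x * of_real (\<phi> x) = of_real (\<sigma>\<^sup>2) * (u x * of_real (\<phi> x))"
      using ode by eventually_elim simp
  qed
  then have w_int: "(LINT x|?M. w x * of_real (\<phi> x)) = of_real (\<sigma>\<^sup>2) * (LINT x|?M. u x * of_real (\<phi> x))"
    by simp
  have weak: "(LINT x|?M. u x * of_real (deriv \<phi> x)) = - (LINT x|?M. v x * of_real (\<phi> x))"
    "(LINT x|?M. v x * of_real (deriv \<phi> x)) = - (LINT x|?M. w x * of_real (\<phi> x))"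
    using uv vw \<phi> by (auto simp: has_weak_derivative_def)
  show "(LINT x|?M. (v x + of_real \<sigma> * u x) * of_real (deriv \<phi> x)) =
      - of_real \<sigma> * (LINT x|?M. (v x + of_real \<sigma> * u x) * of_real (\<phi> x))"
    unfolding split[OF test_function_continuous(1)[OF \<phi>]] split[OF test_function_continuous(2)[OF \<phi>]] weak w_int
    by (simp add: algebra_simps power2_eq_square)
qed

text \<open>
  The factorisations with \<open>\<sigma> = \<kappa>\<close> and \<open>\<sigma> = - \<kappa>\<close> determine \<open>u' + \<kappa> u\<close> and \<open>u' - \<kappa> u\<close>, hence \<open>u\<close>
  and \<open>u'\<close> together. The basis of hyperbolic functions is adapted to boundary conditions at \<open>0\<close>.
\<close>

lemma weak_ode_solution:
  assumes "a < b" "\<kappa> \<noteq> 0" and uv: "has_weak_derivative a b u v" and vw: "has_weak_derivative a b v w"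
    and ode: "AE x in lebesgue_on {a<..<b}. w x = of_real (\<kappa>\<^sup>2) * u x"
  obtains A B where
    "AE x in lebesgue_on {a<..<b}. u x = A * of_real (cosh (\<kappa> * x)) + B * of_real (sinh (\<kappa> * x))"
    "AE x in lebesgue_on {a<..<b}. v x =
       of_real \<kappa> * (A * of_real (sinh (\<kappa> * x)) + B * of_real (cosh (\<kappa> * x)))"
proof -
  obtain C where C: "AE x in lebesgue_on {a<..<b}. v x + of_real \<kappa> * u x = C * of_real (exp (\<kappa> * x))"
    using weak_factor[OF assms(1) uv vw ode] ..
  have "AE x in lebesgue_on {a<..<b}. w x = of_real ((- \<kappa>)\<^sup>2) * u x"
    using ode by simp
  then obtain D where D: "AE x in lebesgue_on {a<..<b}. v x + of_real (- \<kappa>) * u x = D * of_real (exp (- \<kappa> * x))"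
    using weak_factor[OF assms(1) uv vw, of "- \<kappa>"] by auto
  have e: "exp (\<kappa> * x) = cosh (\<kappa> * x) + sinh (\<kappa> * x)" "exp (- \<kappa> * x) = cosh (\<kappa> * x) - sinh (\<kappa> * x)" for x
    by (simp_all add: cosh_plus_sinh cosh_minus_sinh)
  have k: "complex_of_real \<kappa> \<noteq> 0" using \<open>\<kappa> \<noteq> 0\<close> by simp
  show thesis
  proof (rule that)
    let ?A = "(C - D) / (2 * of_real \<kappa>)" and ?B = "(C + D) / (2 * of_real \<kappa>)"
    show "AE x in lebesgue_on {a<..<b}. u x = ?A * of_real (cosh (\<kappa> * x)) + ?B * of_real (sinh (\<kappa> * x))"
      using C D
    proof eventually_elim
      case (elim x)
      have "2 * of_real \<kappa> * u x = (v x + of_real \<kappa> * u x) - (v x + of_real (- \<kappa>) * u x)" by simp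
      also have "\<dots> = (C - D) * of_real (cosh (\<kappa> * x)) + (C + D) * of_real (sinh (\<kappa> * x))"
        unfolding elim e by (simp add: algebra_simps)
      finally have eq: "2 * of_real \<kappa> * u x = (C - D) * of_real (cosh (\<kappa> * x)) + (C + D) * of_real (sinh (\<kappa> * x))" .
      have "u x = (2 * of_real \<kappa> * u x) / (2 * of_real \<kappa>)"
        using k by simp
      then show ?case
        unfolding eq by (subst (asm) add_divide_distrib) (simp only: times_divide_eq_left)
    qed
    show "AE x in lebesgue_on {a<..<b}. v x =
       of_real \<kappa> * (?A * of_real (sinh (\<kappa> * x)) + ?B * of_real (cosh (\<kappa> * x)))"
      using C D
    proof eventually_elim
      case (elim x)
      have "2 * v x = (v x + of_real \<kappa> * u x) + (v x + of_real (- \<kappa>) * u x)" by simp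
      also have "\<dots> = (C - D) * of_real (sinh (\<kappa> * x)) + (C + D) * of_real (cosh (\<kappa> * x))"
        unfolding elim e by (simp add: algebra_simps)
      finally have eq: "2 * v x = (C - D) * of_real (sinh (\<kappa> * x)) + (C + D) * of_real (cosh (\<kappa> * x))" .
      have "of_real \<kappa> * (?A * of_real (sinh (\<kappa> * x)) + ?B * of_real (cosh (\<kappa> * x)))
          = (of_real \<kappa> * ?A) * of_real (sinh (\<kappa> * x)) + (of_real \<kappa> * ?B) * of_real (cosh (\<kappa> * x))"
        by (simp only: distrib_left mult.assoc)
      also have "\<dots> = (C - D) / 2 * of_real (sinh (\<kappa> * x)) + (C + D) / 2 * of_real (cosh (\<kappa> * x))"
        using k by simp
      also have "\<dots> = (2 * v x) / 2"
        unfolding eq by (subst add_divide_distrib) (simp only: times_divide_eq_left)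
      finally show ?case by simp
    qed
  qed
qed

text \<open>
  Two continuous functions that agree almost everywhere on \<open>(a, b)\<close> agree on \<open>[a, b]\<close>, so the
  continuous representative is unique and any one of them gives the point values.
\<close>

lemma point_value_eqI:
  assumes "a < b" and c: "c \<in> {a..b}" and g: "continuous_on {a..b} g"
    and ae: "AE x in lebesgue_on {a<..<b}. f x = g x"
  shows "point_value a b f c = g c"
  unfolding point_value_def
proof (rule the_equality)
  show "\<exists>g'. continuous_on {a..b} g' \<and> (AE x in lebesgue_on {a<..<b}. f x = g' x) \<and> g' c = g c"
    using g ae by auto
next
  fix z assume "\<exists>g'. continuous_on {a..b} g' \<and> (AE x in lebesgue_on {a<..<b}. f x = g' x) \<and> g' c = z"
  then obtain g' where g': "continuous_on {a..b} g'" "AE x in lebesgue_on {a<..<b}. f x = g' x" "g' c = z"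
    by auto
  have ae1: "AE x in lebesgue_on {a<..<b}. g' x - g x = 0"
    using ae g'(2) by eventually_elim simp
  have Int_in: "{a<..<b} \<inter> space lebesgue \<in> sets lebesgue" by simp
  from ae1 have ae0: "AE x \<in> {a<..<b} in lebesgue. x \<in> {x \<in> {a..b}. g' x - g x = 0}"
    unfolding AE_restrict_space_iff[OF Int_in] by eventually_elim auto
  have "closed {x \<in> {a..b}. g' x - g x = 0}"
    by (intro continuous_closed_preimage_constant continuous_intros g g')
  then have "g' x - g x = 0" if "x \<in> {a<..<b}" for x
    using mem_closed_if_AE_lebesgue_open[OF _ _ ae0 that] by auto
  moreover have closure: "closure {a<..<b} = {a..b}" using \<open>a < b\<close> by simp
  moreover have "continuous_on (closure {a<..<b}) (\<lambda>x. g' x - g x)"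
    unfolding closure by (rule continuous_on_diff[OF g'(1) g])
  ultimately have "g' c - g c = 0"
    using c continuous_constant_on_closure[of "{a<..<b}" "\<lambda>x. g' x - g x" 0 c] by blast
  then show "z = g c" using g' by simp
qed

section \<open>Eigenfunctions in terms of their vertex values\<close>

lemma integral_cosh_squared:
  assumes "0 \<le> (l::real)" "\<kappa> \<noteq> 0"
  shows "(LINT x|lebesgue_on {0<..<l}. (cosh (\<kappa> * x))\<^sup>2) = l / 2 + sinh (\<kappa> * l) * cosh (\<kappa> * l) / (2 * \<kappa>)"
proof -
  have D: "((\<lambda>x. x / 2 + sinh (\<kappa> * x) * cosh (\<kappa> * x) / (2 * \<kappa>)) has_real_derivative (cosh (\<kappa> * x))\<^sup>2) (at x)" for x
  proof -
    have "((\<lambda>x. x / 2 + sinh (\<kappa> * x) * cosh (\<kappa> * x) / (2 * \<kappa>)) has_real_derivative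
        1 / 2 + (cosh (\<kappa> * x) * \<kappa> * cosh (\<kappa> * x) + sinh (\<kappa> * x) * \<kappa> * sinh (\<kappa> * x)) / (2 * \<kappa>)) (at x)"
      using assms(2) by (auto intro!: derivative_eq_intros simp: field_simps)
    also have "1 / 2 + (cosh (\<kappa> * x) * \<kappa> * cosh (\<kappa> * x) + sinh (\<kappa> * x) * \<kappa> * sinh (\<kappa> * x)) / (2 * \<kappa>) = (cosh (\<kappa> * x))\<^sup>2"
      using assms(2) cosh_square_eq[of "\<kappa> * x"] by (simp add: field_simps power2_eq_square)
    finally show ?thesis .
  qed
  have "(LINT x|lebesgue_on {0<..<l}. (cosh (\<kappa> * x))\<^sup>2) =
      (l / 2 + sinh (\<kappa> * l) * cosh (\<kappa> * l) / (2 * \<kappa>)) - (0 / 2 + sinh (\<kappa> * 0) * cosh (\<kappa> * 0) / (2 * \<kappa>))"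
  proof (rule integral_lebesgue_on_Ioo_FTC[OF assms(1)])
    show "continuous_on {0..l} (\<lambda>x. (cosh (\<kappa> * x))\<^sup>2)"
      by (intro continuous_intros)
    show "((\<lambda>x. x / 2 + sinh (\<kappa> * x) * cosh (\<kappa> * x) / (2 * \<kappa>)) has_vector_derivative (cosh (\<kappa> * x))\<^sup>2)
        (at x within {0..l})" for x
      using D[of x] unfolding has_real_derivative_iff_has_vector_derivative
      by (rule has_vector_derivative_at_within)
  qed
  then show ?thesis by simp
qed

lemma integral_sinh_squared:
  assumes "0 \<le> (l::real)" "\<kappa> \<noteq> 0"
  shows "(LINT x|lebesgue_on {0<..<l}. (sinh (\<kappa> * x))\<^sup>2) = sinh (\<kappa> * l) * cosh (\<kappa> * l) / (2 * \<kappa>) - l / 2"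
proof -
  interpret finite_measure "lebesgue_on {0<..<l}"
    by (rule finite_measure_lebesgue_on) auto
  have "(LINT x|lebesgue_on {0<..<l}. (sinh (\<kappa> * x))\<^sup>2) = (LINT x|lebesgue_on {0<..<l}. (cosh (\<kappa> * x))\<^sup>2 - 1)"
    by (simp add: sinh_square_eq)
  also have "\<dots> = (LINT x|lebesgue_on {0<..<l}. (cosh (\<kappa> * x))\<^sup>2) - (LINT x|lebesgue_on {0<..<l}. 1)"
    by (intro Bochner_Integration.integral_diff continuous_imp_integrable_lebesgue_on_Ioo continuous_intros)
  also have "(LINT x|lebesgue_on {0<..<l}. 1) = l"
    using assms by (simp add: measure_restrict_space)
  finally show ?thesis using assms by (simp add: integral_cosh_squared)
qed

lemma has_weak_derivative_weak_deriv:
  assumes "H1_on a b f"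
  shows "has_weak_derivative a b f (weak_deriv a b f)"
  using assms unfolding H1_on_def weak_deriv_def by (rule someI_ex)

lemma L2_norm_squared_AE:
  assumes "continuous_on {a..b} g" "L2_on a b f" "AE x in lebesgue_on {a<..<b}. f x = A * of_real (g x)"
  shows "(L2_norm a b f)\<^sup>2 = (cmod A)\<^sup>2 * (LINT x|lebesgue_on {a<..<b}. (g x)\<^sup>2)"
proof -
  have "(L2_norm a b f)\<^sup>2 = (LINT x|lebesgue_on {a<..<b}. (cmod (f x))\<^sup>2)"
    unfolding L2_norm_def by (intro real_sqrt_pow2 Bochner_Integration.integral_nonneg) auto
  also have "\<dots> = (LINT x|lebesgue_on {a<..<b}. (cmod A)\<^sup>2 * (g x)\<^sup>2)"
  proof (rule integral_cong_AE)
    show "(\<lambda>x. (cmod (f x))\<^sup>2) \<in> borel_measurable (lebesgue_on {a<..<b})"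
      using assms by (auto simp: L2_on_def)
    show "(\<lambda>x. (cmod A)\<^sup>2 * (g x)\<^sup>2) \<in> borel_measurable (lebesgue_on {a<..<b})"
      by (intro borel_measurable_integrable continuous_imp_integrable_lebesgue_on_Ioo continuous_intros assms)
    show "AE x in lebesgue_on {a<..<b}. (cmod (f x))\<^sup>2 = (cmod A)\<^sup>2 * (g x)\<^sup>2"
      using assms(3) by eventually_elim (simp add: norm_mult power_mult_distrib)
  qed
  finally show ?thesis by simp
qed

text \<open>
  The squared \<open>L\<^sub>2\<close> norm over the short edge of \<open>cosh (\<kappa> x) / cosh (\<kappa> \<epsilon>)\<close>, which is the solution with
  value \<open>1\<close> at the central vertex.
\<close>

definition short_weight :: "real \<Rightarrow> real \<Rightarrow> real" where
  "short_weight \<epsilon> \<kappa> = \<epsilon> / (2 * (cosh (\<kappa> * \<epsilon>))\<^sup>2) + tanh (\<kappa> * \<epsilon>) / (2 * \<kappa>)"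

text \<open>
  The squared \<open>L\<^sub>2\<close> norm over \<open>(0, 1)\<close> of \<open>sinh (\<kappa> x) / sinh \<kappa>\<close>.
\<close>

definition edge_weight :: "real \<Rightarrow> real" where
  "edge_weight \<kappa> = 1 / (2 * \<kappa> * tanh \<kappa>) - 1 / (2 * (sinh \<kappa>)\<^sup>2)"

text \<open>
  The conditions at the outer end points select \<open>cosh (\<kappa> x)\<close> on the short edge and \<open>sinh (\<kappa> x)\<close> on the
  long one. So an eigenfunction is determined by its two values at the central vertex, and its
  derivatives there as well as its norms are explicit multiples of these values.
\<close>

lemma eigenfunction_vertex_form:
  assumes eig: "eigenfunction P T \<epsilon> (- \<kappa>\<^sup>2) \<psi>" and "\<kappa> > 0" "\<epsilon> > 0"
  obtains y z where
    "vertex_values \<epsilon> \<psi> = vector [y, z]"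
    "vertex_derivatives \<epsilon> \<psi> =
       vector [- of_real (\<kappa> * tanh (\<kappa> * \<epsilon>)) * y, - of_real (\<kappa> / tanh \<kappa>) * z]"
    "(short_norm \<epsilon> \<psi>)\<^sup>2 = (cmod y)\<^sup>2 * short_weight \<epsilon> \<kappa>"
    "(edge_norm \<psi>)\<^sup>2 = (cmod z)\<^sup>2 * edge_weight \<kappa>"
proof -
  define u v where "u = fst \<psi>" and "v = snd \<psi>"
  have dom: "\<psi> \<in> H_domain P T \<epsilon>" and ev: "graph_ae_eq \<epsilon> (H_op \<epsilon> \<psi>) (\<lambda>x. of_real (- \<kappa>\<^sup>2) * fst \<psi> x, \<lambda>x. of_real (- \<kappa>\<^sup>2) * snd \<psi> x)"
    using eig by (auto simp: eigenfunction_def)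
  have H2: "H2_on 0 \<epsilon> u" "H2_on 0 1 v" and bc: "point_value 0 \<epsilon> (weak_deriv 0 \<epsilon> u) 0 = 0" "point_value 0 1 v 0 = 0"
    using dom by (auto simp: H_domain_def u_def v_def)
  have ode: "AE x in lebesgue_on {0<..<\<epsilon>}. weak_deriv 0 \<epsilon> (weak_deriv 0 \<epsilon> u) x = of_real (\<kappa>\<^sup>2) * u x"
    "AE x in lebesgue_on {0<..<1}. weak_deriv 0 1 (weak_deriv 0 1 v) x = of_real (\<kappa>\<^sup>2) * v x"
    using ev by (auto simp: graph_ae_eq_def H_op_def u_def v_def)
  have uw: "has_weak_derivative 0 \<epsilon> u (weak_deriv 0 \<epsilon> u)" "has_weak_derivative 0 \<epsilon> (weak_deriv 0 \<epsilon> u) (weak_deriv 0 \<epsilon> (weak_deriv 0 \<epsilon> u))"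
    and vw: "has_weak_derivative 0 1 v (weak_deriv 0 1 v)" "has_weak_derivative 0 1 (weak_deriv 0 1 v) (weak_deriv 0 1 (weak_deriv 0 1 v))"
    using H2 by (auto simp: H2_on_def intro: has_weak_derivative_weak_deriv)
  have L2: "L2_on 0 \<epsilon> u" "L2_on 0 1 v" using uw(1) vw(1) by (auto simp: has_weak_derivative_def)
  have "\<kappa> \<noteq> 0" using \<open>\<kappa> > 0\<close> by simp
  obtain A B where u: "AE x in lebesgue_on {0<..<\<epsilon>}. u x = A * of_real (cosh (\<kappa> * x)) + B * of_real (sinh (\<kappa> * x))"
    and u': "AE x in lebesgue_on {0<..<\<epsilon>}. weak_deriv 0 \<epsilon> u x = of_real \<kappa> * (A * of_real (sinh (\<kappa> * x)) + B * of_real (cosh (\<kappa> * x)))"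
    using weak_ode_solution[OF \<open>\<epsilon> > 0\<close> \<open>\<kappa> \<noteq> 0\<close> uw ode(1)] by blast
  obtain C D where v: "AE x in lebesgue_on {0<..<1}. v x = C * of_real (cosh (\<kappa> * x)) + D * of_real (sinh (\<kappa> * x))"
    and v': "AE x in lebesgue_on {0<..<1}. weak_deriv 0 1 v x = of_real \<kappa> * (C * of_real (sinh (\<kappa> * x)) + D * of_real (cosh (\<kappa> * x)))"
    using weak_ode_solution[OF zero_less_one \<open>\<kappa> \<noteq> 0\<close> vw ode(2)] by blast
  have "0 = of_real \<kappa> * (A * of_real (sinh (\<kappa> * 0)) + B * complex_of_real (cosh (\<kappa> * 0)))"
    unfolding bc(1)[symmetric] using \<open>\<epsilon> > 0\<close> by (intro point_value_eqI u') (auto intro!: continuous_intros)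
  then have "B = 0" using \<open>\<kappa> > 0\<close> by simp
  have "0 = C * of_real (cosh (\<kappa> * 0)) + D * complex_of_real (sinh (\<kappa> * 0))"
    unfolding bc(2)[symmetric] by (intro point_value_eqI v) (auto intro!: continuous_intros)
  then have "C = 0" by simp
  note uv = u[unfolded \<open>B = 0\<close>, simplified] u'[unfolded \<open>B = 0\<close>, simplified]
    v[unfolded \<open>C = 0\<close>, simplified] v'[unfolded \<open>C = 0\<close>, simplified]
  have ue: "point_value 0 \<epsilon> u \<epsilon> = A * of_real (cosh (\<kappa> * \<epsilon>))"
    using \<open>\<epsilon> > 0\<close> by (intro point_value_eqI uv) (auto intro!: continuous_intros)
  have ue': "point_value 0 \<epsilon> (weak_deriv 0 \<epsilon> u) \<epsilon> = of_real \<kappa> * (A * of_real (sinh (\<kappa> * \<epsilon>)))"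
    using \<open>\<epsilon> > 0\<close> by (intro point_value_eqI uv) (auto intro!: continuous_intros)
  have ve: "point_value 0 1 v 1 = D * of_real (sinh (\<kappa> * 1))"
    by (intro point_value_eqI uv) (auto intro!: continuous_intros)
  have ve': "point_value 0 1 (weak_deriv 0 1 v) 1 = of_real \<kappa> * (D * of_real (cosh (\<kappa> * 1)))"
    by (intro point_value_eqI uv) (auto intro!: continuous_intros)
  have pos: "cosh (\<kappa> * \<epsilon>) > 0" "sinh \<kappa> > 0" "cosh \<kappa> > 0" "sinh (\<kappa> * \<epsilon>) > 0" using \<open>\<kappa> > 0\<close> \<open>\<epsilon> > 0\<close> by auto
  show thesis
  proof (rule that[of "A * of_real (cosh (\<kappa> * \<epsilon>))" "D * of_real (sinh \<kappa>)"])
    show "vertex_values \<epsilon> \<psi> = vector [A * of_real (cosh (\<kappa> * \<epsilon>)), D * of_real (sinh \<kappa>)]"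
      using ue ve by (simp add: vertex_values_def u_def v_def)
    show "vertex_derivatives \<epsilon> \<psi> = vector [- of_real (\<kappa> * tanh (\<kappa> * \<epsilon>)) * (A * of_real (cosh (\<kappa> * \<epsilon>))), - of_real (\<kappa> / tanh \<kappa>) * (D * of_real (sinh \<kappa>))]"
    proof -
      have "of_real (\<kappa> * tanh (\<kappa> * \<epsilon>)) * (A * of_real (cosh (\<kappa> * \<epsilon>))) = of_real \<kappa> * (A * of_real (sinh (\<kappa> * \<epsilon>)))"
        using pos by (simp add: tanh_def)
      moreover have "of_real (\<kappa> / tanh \<kappa>) * (D * of_real (sinh \<kappa>)) = of_real \<kappa> * (D * of_real (cosh \<kappa>))"
        using pos by (simp add: tanh_def)
      moreover have "vertex_derivatives \<epsilon> \<psi> =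
          vector [- (of_real \<kappa> * (A * of_real (sinh (\<kappa> * \<epsilon>)))), - (of_real \<kappa> * (D * of_real (cosh \<kappa>)))]"
        using ue' ve' by (simp add: vertex_derivatives_def u_def v_def)
      ultimately show ?thesis
        by (simp only: mult_minus_left)
    qed
    have "(short_norm \<epsilon> \<psi>)\<^sup>2 = (cmod A)\<^sup>2 * (\<epsilon> / 2 + sinh (\<kappa> * \<epsilon>) * cosh (\<kappa> * \<epsilon>) / (2 * \<kappa>))"
      using L2_norm_squared_AE[OF _ L2(1) uv(1)] \<open>\<epsilon> > 0\<close> \<open>\<kappa> > 0\<close> unfolding short_norm_def u_def[symmetric]
      by (simp add: integral_cosh_squared continuous_intros)
    also have "\<dots> = (cmod (A * of_real (cosh (\<kappa> * \<epsilon>))))\<^sup>2 * short_weight \<epsilon> \<kappa>"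
      using pos by (simp add: short_weight_def norm_mult tanh_def field_simps power2_eq_square)
    finally show "(short_norm \<epsilon> \<psi>)\<^sup>2 = \<dots>" .
    have "(edge_norm \<psi>)\<^sup>2 = (cmod D)\<^sup>2 * (sinh \<kappa> * cosh \<kappa> / (2 * \<kappa>) - 1 / 2)"
      using L2_norm_squared_AE[OF _ L2(2) uv(3)] \<open>\<kappa> > 0\<close> unfolding edge_norm_def v_def[symmetric]
      by (simp add: integral_sinh_squared continuous_intros)
    also have "\<dots> = (cmod (D * of_real (sinh \<kappa>)))\<^sup>2 * edge_weight \<kappa>"
      using pos \<open>\<kappa> > 0\<close> by (simp add: edge_weight_def norm_mult tanh_def field_simps power2_eq_square)
    finally show "(edge_norm \<psi>)\<^sup>2 = \<dots>" .
  qed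
qed

section \<open>The two shapes of a vertex condition\<close>

text \<open>
  The vertex values lie in the range \<open>V\<close> of \<open>Q\<close>. If \<open>V\<close> is the whole plane, then \<open>T\<close> is a Hermitian
  matrix and the condition reads \<open>U' = T U\<close>. Otherwise all values are multiples of one vector
  \<open>q\<close>, and pairing the condition with \<open>q\<close> leaves one scalar equation. The zero subspace is included
  in the second case by \<open>q = 0\<close>.
\<close>

lemma vertex_conditions_cases:
  assumes vc: "vertex_conditions P T"
  obtains
    (full) t s :: real and b :: complex where
      "\<And>U U'. P *v U = 0 \<Longrightarrow>
        complementary_projection P *v U' = T (complementary_projection P *v U) \<Longrightarrow>
        U' $ 1 = of_real t * U $ 1 + b * U $ 2 \<and> U' $ 2 = cnj b * U $ 1 + of_real s * U $ 2"
  | (line) q1 q2 t :: complex where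
      "\<And>U U'. P *v U = 0 \<Longrightarrow>
        complementary_projection P *v U' = T (complementary_projection P *v U) \<Longrightarrow>
        \<exists>c. U $ 1 = c * q1 \<and> U $ 2 = c * q2 \<and> U' $ 1 * cnj q1 + U' $ 2 * cnj q2 = c * t"
proof -
  define Q where "Q = complementary_projection P"
  define V where "V = range (\<lambda>x. Q *v x)"
  have PP: "P *v (P *v x) = P *v x" and Psym: "cinner2 (P *v x) y = cinner2 x (P *v y)" for x y
    using vc by (auto simp: vertex_conditions_def orthogonal_projection_def matrix_vector_mul_assoc)
  have TV: "T x \<in> V" and Tadd: "y \<in> V \<Longrightarrow> T (x + y) = T x + T y" and Tscale: "T (c *s x) = c *s T x"
    and Tsym: "y \<in> V \<Longrightarrow> cinner2 (T x) y = cinner2 x (T y)" if "x \<in> V" for x y c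
    using vc that by (auto simp: vertex_conditions_def selfadjoint_on_def Q_def V_def)
  have Q: "Q *v x = x - P *v x" for x
    by (simp add: Q_def complementary_projection_def matrix_vector_mult_diff_rdistrib)
  have QV: "Q *v x = x" if "x \<in> V" for x
    using that by (auto simp: V_def Q PP matrix_vector_mult_diff_distrib)
  have Qsym: "cinner2 (Q *v x) y = cinner2 x (Q *v y)" for x y
    using Psym[of x y] by (simp add: Q cinner2_def sum_2 algebra_simps)
  have inV: "Q *v U = U" "U \<in> V" if "P *v U = 0" for U
  proof -
    show "Q *v U = U" using that by (simp add: Q)
    then show "U \<in> V" unfolding V_def by (metis rangeI)
  qed
  show thesis
  proof (cases "\<exists>x\<in>V. \<exists>y\<in>V. x $ 1 * y $ 2 \<noteq> x $ 2 * y $ 1")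
    case True
    then obtain x y where x: "x \<in> V" and y: "y \<in> V" and det: "x $ 1 * y $ 2 - x $ 2 * y $ 1 \<noteq> 0"
      by auto
    have Qw: "Q *v w = w" for w
    proof -
      \<comment> \<open>Cramer's rule for \<open>w\<close> in the basis \<open>x, y\<close>.\<close>
      define d where "d = x $ 1 * y $ 2 - x $ 2 * y $ 1"
      define \<alpha> where "\<alpha> = (w $ 1 * y $ 2 - w $ 2 * y $ 1) / d"
      define \<beta> where "\<beta> = (x $ 1 * w $ 2 - x $ 2 * w $ 1) / d"
      have "(w $ 1 * y $ 2 - w $ 2 * y $ 1) * x $ 1 + (x $ 1 * w $ 2 - x $ 2 * w $ 1) * y $ 1 = w $ 1 * d"
        "(w $ 1 * y $ 2 - w $ 2 * y $ 1) * x $ 2 + (x $ 1 * w $ 2 - x $ 2 * w $ 1) * y $ 2 = w $ 2 * d"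
        by (simp_all add: d_def algebra_simps)
      then have "\<alpha> * x $ 1 + \<beta> * y $ 1 = w $ 1 * d / d" "\<alpha> * x $ 2 + \<beta> * y $ 2 = w $ 2 * d / d"
        by (simp_all only: \<alpha>_def \<beta>_def times_divide_eq_left add_divide_distrib[symmetric])
      then have w: "w = \<alpha> *s x + \<beta> *s y"
        using det by (simp add: vec_eq_iff forall_2 d_def)
      have "Q *v w = \<alpha> *s (Q *v x) + \<beta> *s (Q *v y)"
        unfolding w by (simp add: matrix_vector_right_distrib vector_scalar_commute)
      then show ?thesis using QV x y w by simp
    qed
    then have V: "w \<in> V" for w unfolding V_def by (metis rangeI)
    define e1 e2 :: "complex ^ 2" where "e1 = vector [1, 0]" and "e2 = vector [0, 1]"
    have e: "e1 $ 1 = 1" "e1 $ 2 = 0" "e2 $ 1 = 0" "e2 $ 2 = 1" by (simp_all add: e1_def e2_def)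
    have T11: "cnj (T e1 $ 1) = T e1 $ 1" and T22: "cnj (T e2 $ 2) = T e2 $ 2" and T21: "T e1 $ 2 = cnj (T e2 $ 1)"
      using Tsym[OF V V, of e1 e1] Tsym[OF V V, of e2 e2] Tsym[OF V V, of e1 e2]
      by (simp_all add: cinner2_def sum_2 e)
    show thesis
    proof (rule full)
      fix U U'
      assume "P *v U = 0" and "complementary_projection P *v U' = T (complementary_projection P *v U)"
      then have "U' = T U" by (simp add: Q_def[symmetric] Qw)
      also have "U = U $ 1 *s e1 + U $ 2 *s e2"
        by (simp add: vec_eq_iff forall_2 e)
      also have "T \<dots> = U $ 1 *s T e1 + U $ 2 *s T e2"
        by (simp add: Tadd Tscale V)
      finally have U': "U' = U $ 1 *s T e1 + U $ 2 *s T e2" .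
      have "T e1 $ 1 = of_real (Re (T e1 $ 1))" "T e2 $ 2 = of_real (Re (T e2 $ 2))"
        using T11 T22 by (simp_all add: complex_eq_iff)
      then show "U' $ 1 = of_real (Re (T e1 $ 1)) * U $ 1 + T e2 $ 1 * U $ 2 \<and>
          U' $ 2 = cnj (T e2 $ 1) * U $ 1 + of_real (Re (T e2 $ 2)) * U $ 2"
        unfolding U' by (simp add: T21[symmetric] mult.commute)
    qed
  next
    case False
    then have par: "x $ 1 * y $ 2 = x $ 2 * y $ 1" if "x \<in> V" "y \<in> V" for x y using that by blast
    obtain q where q: "q \<in> V" "\<And>x. x \<in> V \<Longrightarrow> \<exists>c. x = c *s q"
    proof (cases "\<exists>q\<in>V. q \<noteq> 0")
      case True
      then obtain q where q: "q \<in> V" "q \<noteq> 0" by auto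
      have "\<exists>c. x = c *s q" if "x \<in> V" for x
      proof (cases "q $ 1 = 0")
        case True
        then have "q $ 2 \<noteq> 0" using q(2) by (auto simp: vec_eq_iff forall_2)
        then have "x = (x $ 2 / q $ 2) *s q"
          using par[OF that q(1)] True by (simp add: vec_eq_iff forall_2)
        then show ?thesis by blast
      next
        case False
        then have "x = (x $ 1 / q $ 1) *s q"
          using par[OF that q(1)] by (simp add: vec_eq_iff forall_2 field_simps)
        then show ?thesis by blast
      qed
      then show thesis using q that by blast
    next
      case False
      have "Q *v 0 \<in> V" unfolding V_def by (rule rangeI)
      then have "0 \<in> V" by simp
      moreover have "x = 0 *s 0" if "x \<in> V" for x using False that by auto
      ultimately show thesis using that by blast
    qed
    show thesis
    proof (rule line)
      fix U U'
      assume U: "P *v U = 0" and U': "complementary_projection P *v U' = T (complementary_projection P *v U)"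
      obtain c where c: "U = c *s q" using q(2) inV(2)[OF U] by blast
      have "cinner2 U' q = cinner2 (Q *v U') q"
        using Qsym QV[OF q(1)] by simp
      also have "Q *v U' = c *s T q"
        using U' inV(1)[OF U] by (simp add: Q_def c Tscale[OF q(1)])
      also have "cinner2 \<dots> q = c * cinner2 (T q) q"
        by (simp add: cinner2_def sum_2 algebra_simps)
      finally have "U' $ 1 * cnj (q $ 1) + U' $ 2 * cnj (q $ 2) = c * cinner2 (T q) q"
        by (simp add: cinner2_def sum_2)
      then show "\<exists>c. U $ 1 = c * q $ 1 \<and> U $ 2 = c * q $ 2 \<and>
          U' $ 1 * cnj (q $ 1) + U' $ 2 * cnj (q $ 2) = c * cinner2 (T q) q"
        using c by (intro exI[of _ c]) simp
    qed
  qed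
qed

section \<open>Estimates for the weights and the wave number\<close>

lemma tanh_le_self: "tanh x \<le> x" if "0 \<le> x" for x :: real
proof -
  have "(\<lambda>x. x - tanh x) 0 \<le> (\<lambda>x. x - tanh x) x"
  proof (rule DERIV_nonneg_imp_nondecreasing[OF that])
    fix y :: real assume "0 \<le> y" "y \<le> x"
    have "cosh y \<noteq> 0" using cosh_real_pos[of y] by linarith
    then have "((\<lambda>x. x - tanh x) has_real_derivative (1 - (1 - (tanh y)\<^sup>2))) (at y)"
      by (auto intro!: derivative_eq_intros)
    then show "\<exists>z. ((\<lambda>x. x - tanh x) has_real_derivative z) (at y) \<and> 0 \<le> z"
      by (intro exI[of _ "1 - (1 - (tanh y)\<^sup>2)"]) simp
  qed
  then show ?thesis by simp
qed

lemma short_weight_pos: "0 < short_weight \<epsilon> \<kappa>" if "0 < \<epsilon>" "0 < \<kappa>"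
  unfolding short_weight_def using that by (intro add_pos_pos divide_pos_pos) auto

lemma short_weight_le: "short_weight \<epsilon> \<kappa> \<le> \<epsilon>" if "0 < \<epsilon>" "0 < \<kappa>"
proof -
  have "1 \<le> (cosh (\<kappa> * \<epsilon>))\<^sup>2" by (simp add: cosh_real_ge_1)
  then have "\<epsilon> / (2 * (cosh (\<kappa> * \<epsilon>))\<^sup>2) \<le> \<epsilon> / 2"
    using that by (intro divide_left_mono) auto
  moreover have "tanh (\<kappa> * \<epsilon>) / (2 * \<kappa>) \<le> \<kappa> * \<epsilon> / (2 * \<kappa>)"
    using that by (intro divide_right_mono tanh_le_self) auto
  ultimately show ?thesis unfolding short_weight_def using that by simp
qed

text \<open>
  Over a common denominator this is \<open>\<kappa> < sinh \<kappa> cosh \<kappa>\<close>, which follows by differentiating.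
\<close>

lemma edge_weight_pos: "0 < edge_weight \<kappa>" if "0 < \<kappa>"
proof -
  have pos: "sinh \<kappa> > 0" "cosh \<kappa> > 0" using that by auto
  have "\<kappa> < sinh \<kappa> * cosh \<kappa>"
  proof -
    have "(\<lambda>x. sinh x * cosh x - x) 0 < (\<lambda>x. sinh x * cosh x - x) \<kappa>"
    proof (rule DERIV_pos_imp_increasing_open[OF that])
      show "continuous_on {0..\<kappa>} (\<lambda>x. sinh x * cosh x - x)" by (intro continuous_intros)
      fix y :: real assume "0 < y" "y < \<kappa>"
      then have "0 < 2 * (sinh y)\<^sup>2" by simp
      moreover have "((\<lambda>x. sinh x * cosh x - x) has_real_derivative (2 * (sinh y)\<^sup>2)) (at y)"
        by (auto intro!: derivative_eq_intros simp: power2_eq_square[symmetric] cosh_square_eq)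
      ultimately show "\<exists>z. ((\<lambda>x. sinh x * cosh x - x) has_real_derivative z) (at y) \<and> 0 < z"
        by blast
    qed
    then show ?thesis by simp
  qed
  moreover have "edge_weight \<kappa> = (sinh \<kappa> * cosh \<kappa> - \<kappa>) / (2 * \<kappa> * (sinh \<kappa>)\<^sup>2)"
    using that pos by (simp add: edge_weight_def tanh_def field_simps power2_eq_square)
  ultimately show ?thesis using that pos by simp
qed

text \<open>
  With \<open>y = \<kappa> \<epsilon>\<close>, this is one of the two factors into which the ratio of the squared norms over the two
  edges splits when both edges carry a positive fraction; the other one is that of \<open>edge_factor\<close>.
\<close>

lemma weight_quotient:
  "(\<lambda>y::real. tanh y / y / (1 / (2 * (cosh y)\<^sup>2) + tanh y / (2 * y)) - 1) \<in> O[at_right 0](\<lambda>y. y)"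
  by real_asymp

lemma edge_factor:
  "(\<lambda>k. k\<^sup>2 * edge_weight k / (k / tanh k + s) - 1 / 2) \<in> O[at_top](\<lambda>k. 1 / k)"
  unfolding edge_weight_def by real_asymp

lemma tanh_lower_at_0: "\<forall>\<^sub>F y in at_right (0::real). y / 2 \<le> tanh y"
  by real_asymp

lemma tanh_lower_at_top: "\<forall>\<^sub>F k in at_top. 1 / 2 \<le> tanh (k::real)"
  by real_asymp

text \<open>
  All that the proof needs about the eigenvalue is the order of magnitude of the wave number
  \<open>\<kappa> = sqrt (- \<mu>)\<close>, with \<open>p = 0\<close>, \<open>1/2\<close>, \<open>1/3\<close> for the types (B), (S), (C).
\<close>

lemma wave_number_bounds:
  fixes \<mu> :: "real \<Rightarrow> real"
  assumes "\<alpha> > 0" and \<mu>: "(\<lambda>\<epsilon>. \<mu> \<epsilon> + \<alpha> * \<epsilon> powr (- 2 * p)) \<in> o[at_right 0](\<lambda>\<epsilon>. \<epsilon> powr (- 2 * p))"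
  obtains c C where "c > 0" "C > 0"
    "\<forall>\<^sub>F \<epsilon> in at_right 0. c * \<epsilon> powr (- p) \<le> sqrt (- \<mu> \<epsilon>) \<and> sqrt (- \<mu> \<epsilon>) \<le> C * \<epsilon> powr (- p)"
proof (rule that)
  show "sqrt (\<alpha> / 2) > 0" "sqrt (2 * \<alpha>) > 0" using \<open>\<alpha> > 0\<close> by auto
  have "\<forall>\<^sub>F \<epsilon> in at_right 0. norm (\<mu> \<epsilon> + \<alpha> * \<epsilon> powr (- 2 * p)) \<le> \<alpha> / 2 * norm (\<epsilon> powr (- 2 * p))"
    using \<mu> \<open>\<alpha> > 0\<close> by (intro landau_o.smallD) auto
  then show "\<forall>\<^sub>F \<epsilon> in at_right 0. sqrt (\<alpha> / 2) * \<epsilon> powr (- p) \<le> sqrt (- \<mu> \<epsilon>) \<and> sqrt (- \<mu> \<epsilon>) \<le> sqrt (2 * \<alpha>) * \<epsilon> powr (- p)"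
    using eventually_at_right_less[of 0]
  proof eventually_elim
    case (elim \<epsilon>)
    have "\<epsilon> powr (- 2 * p) = (\<epsilon> powr (- p))\<^sup>2"
      using elim by (simp add: powr_power)
    then have sq: "sqrt (c * \<epsilon> powr (- 2 * p)) = sqrt c * \<epsilon> powr (- p)" for c
      by (simp add: real_sqrt_mult)
    define X where "X = \<alpha> * \<epsilon> powr (- 2 * p)"
    have "\<bar>\<mu> \<epsilon> + X\<bar> \<le> X / 2" using elim(1) by (simp add: X_def)
    then have "X / 2 \<le> - \<mu> \<epsilon>" "- \<mu> \<epsilon> \<le> 2 * X"
      unfolding abs_le_iff by linarith+
    then have "\<alpha> / 2 * \<epsilon> powr (- 2 * p) \<le> - \<mu> \<epsilon>" "- \<mu> \<epsilon> \<le> 2 * \<alpha> * \<epsilon> powr (- 2 * p)"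
      by (simp_all add: X_def)
    then show ?case unfolding sq[symmetric] by simp
  qed
qed

section \<open>Families of eigenfunctions as the short edge shrinks\<close>

text \<open>
  Here \<open>\<kappa>\<close> is the wave number, \<open>y\<close> and \<open>z\<close> are the vertex values on the short and the long edge, and
  \<open>S\<close> and \<open>E\<close> are the squared norms over these edges.
\<close>

locale eigenfunction_branch =
  fixes P :: "complex ^ 2 ^ 2" and T :: "complex ^ 2 \<Rightarrow> complex ^ 2"
    and \<kappa> :: "real \<Rightarrow> real" and y z :: "real \<Rightarrow> complex" and S E :: "real \<Rightarrow> real"
  assumes vertex: "vertex_conditions P T"
    and pos: "\<forall>\<^sub>F \<epsilon> in at_right 0. 0 < \<epsilon> \<and> 0 < \<kappa> \<epsilon>"
    and bc: "\<forall>\<^sub>F \<epsilon> in at_right 0. P *v vector [y \<epsilon>, z \<epsilon>] = 0 \<and>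
      complementary_projection P *v vector [- of_real (\<kappa> \<epsilon> * tanh (\<kappa> \<epsilon> * \<epsilon>)) * y \<epsilon>, - of_real (\<kappa> \<epsilon> / tanh (\<kappa> \<epsilon>)) * z \<epsilon>]
        = T (complementary_projection P *v vector [y \<epsilon>, z \<epsilon>])"
    and S: "\<forall>\<^sub>F \<epsilon> in at_right 0. S \<epsilon> = (cmod (y \<epsilon>))\<^sup>2 * short_weight \<epsilon> (\<kappa> \<epsilon>)"
    and E: "\<forall>\<^sub>F \<epsilon> in at_right 0. E \<epsilon> = (cmod (z \<epsilon>))\<^sup>2 * edge_weight (\<kappa> \<epsilon>)"
    and total: "\<forall>\<^sub>F \<epsilon> in at_right 0. S \<epsilon> + E \<epsilon> = 1"
begin

text \<open>
  The ratios of derivative to value at the central vertex on the short edge (\<open>d\<^sub>1\<close>) and on the long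
  edge (\<open>d\<^sub>2\<close>).
\<close>

definition d\<^sub>1 :: "real \<Rightarrow> real" where "d\<^sub>1 \<epsilon> = \<kappa> \<epsilon> * tanh (\<kappa> \<epsilon> * \<epsilon>)"
definition d\<^sub>2 :: "real \<Rightarrow> real" where "d\<^sub>2 \<epsilon> = \<kappa> \<epsilon> / tanh (\<kappa> \<epsilon>)"

lemma nonneg: "\<forall>\<^sub>F \<epsilon> in at_right 0. 0 \<le> S \<epsilon> \<and> 0 \<le> E \<epsilon>"
  using pos S E
  by eventually_elim (auto intro!: mult_nonneg_nonneg less_imp_le[OF short_weight_pos] less_imp_le[OF edge_weight_pos])

lemma d\<^sub>1_pos: "\<forall>\<^sub>F \<epsilon> in at_right 0. 0 < d\<^sub>1 \<epsilon>"
  using pos by eventually_elim (auto simp: d\<^sub>1_def)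

lemma d\<^sub>1_le: "\<forall>\<^sub>F \<epsilon> in at_right 0. d\<^sub>1 \<epsilon> \<le> (\<kappa> \<epsilon>)\<^sup>2 * \<epsilon>"
  using pos
proof eventually_elim
  case (elim \<epsilon>)
  then have "\<kappa> \<epsilon> * tanh (\<kappa> \<epsilon> * \<epsilon>) \<le> \<kappa> \<epsilon> * (\<kappa> \<epsilon> * \<epsilon>)"
    by (intro mult_left_mono tanh_le_self) auto
  then show ?case by (simp add: d\<^sub>1_def power2_eq_square mult.assoc)
qed

lemma d\<^sub>2_ge: "\<forall>\<^sub>F \<epsilon> in at_right 0. \<kappa> \<epsilon> \<le> d\<^sub>2 \<epsilon>"
  using pos
proof eventually_elim
  case (elim \<epsilon>)
  have "tanh (\<kappa> \<epsilon>) \<le> 1" "0 < tanh (\<kappa> \<epsilon>)"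
    using elim tanh_real_lt_1[of "\<kappa> \<epsilon>"] by auto
  then have "\<kappa> \<epsilon> / 1 \<le> \<kappa> \<epsilon> / tanh (\<kappa> \<epsilon>)"
    using elim by (intro divide_left_mono) auto
  then show ?case by (simp add: d\<^sub>2_def)
qed

lemma d\<^sub>1_tendsto_0:
  assumes "((\<lambda>\<epsilon>. (\<kappa> \<epsilon>)\<^sup>2 * \<epsilon>) \<longlongrightarrow> 0) (at_right 0)"
  shows "(d\<^sub>1 \<longlongrightarrow> 0) (at_right 0)"
  using d\<^sub>1_pos by (intro tendsto_sandwich[OF _ d\<^sub>1_le tendsto_const assms]) (auto elim: eventually_mono)

text \<open>
  In the rigid case the multiplier \<open>c\<close> is nonzero because of the normalisation, and it cancels: the
  vertex condition becomes an equation for the wave number alone.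
\<close>

lemma coupling_cases:
  obtains
    (coupled) t s :: real and b :: complex where
      "\<forall>\<^sub>F \<epsilon> in at_right 0. of_real (t + d\<^sub>1 \<epsilon>) * y \<epsilon> = - b * z \<epsilon> \<and> of_real (s + d\<^sub>2 \<epsilon>) * z \<epsilon> = - cnj b * y \<epsilon>"
  | (rigid) q1 q2 t :: complex where
      "\<forall>\<^sub>F \<epsilon> in at_right 0. (\<exists>c. c \<noteq> 0 \<and> y \<epsilon> = c * q1 \<and> z \<epsilon> = c * q2) \<and>
         of_real (d\<^sub>1 \<epsilon> * (cmod q1)\<^sup>2 + d\<^sub>2 \<epsilon> * (cmod q2)\<^sup>2) = - t"
  using vertex
proof (cases rule: vertex_conditions_cases)
  case (full t s b)
  have "\<forall>\<^sub>F \<epsilon> in at_right 0. of_real (t + d\<^sub>1 \<epsilon>) * y \<epsilon> = - b * z \<epsilon> \<and> of_real (s + d\<^sub>2 \<epsilon>) * z \<epsilon> = - cnj b * y \<epsilon>"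
    using bc
  proof eventually_elim
    case (elim \<epsilon>)
    have "- of_real (d\<^sub>1 \<epsilon>) * y \<epsilon> = of_real t * y \<epsilon> + b * z \<epsilon> \<and> - of_real (d\<^sub>2 \<epsilon>) * z \<epsilon> = cnj b * y \<epsilon> + of_real s * z \<epsilon>"
      using full[OF elim[THEN conjunct1] elim[THEN conjunct2]] by (simp add: d\<^sub>1_def d\<^sub>2_def)
    then show ?case by (simp add: algebra_simps eq_neg_iff_add_eq_0) (metis add.assoc add.commute add.right_inverse)
  qed
  then show thesis by (rule coupled)
next
  case (line q1 q2 t)
  have "\<forall>\<^sub>F \<epsilon> in at_right 0. (\<exists>c. c \<noteq> 0 \<and> y \<epsilon> = c * q1 \<and> z \<epsilon> = c * q2) \<and>
         of_real (d\<^sub>1 \<epsilon> * (cmod q1)\<^sup>2 + d\<^sub>2 \<epsilon> * (cmod q2)\<^sup>2) = - t"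
    using bc S E total
  proof eventually_elim
    case (elim \<epsilon>)
    have "\<exists>c. y \<epsilon> = c * q1 \<and> z \<epsilon> = c * q2 \<and>
        - of_real (d\<^sub>1 \<epsilon>) * y \<epsilon> * cnj q1 + - of_real (d\<^sub>2 \<epsilon>) * z \<epsilon> * cnj q2 = c * t"
      using line[OF elim(1)[THEN conjunct1] elim(1)[THEN conjunct2]]
      by (simp only: vector_2 d\<^sub>1_def d\<^sub>2_def)
    then obtain c where c: "y \<epsilon> = c * q1" "z \<epsilon> = c * q2"
      "- of_real (d\<^sub>1 \<epsilon>) * y \<epsilon> * cnj q1 + - of_real (d\<^sub>2 \<epsilon>) * z \<epsilon> * cnj q2 = c * t"
      by blast
    have "c \<noteq> 0" using c(1,2) elim(2,3,4) by auto
    have "c * of_real (d\<^sub>1 \<epsilon> * (cmod q1)\<^sup>2 + d\<^sub>2 \<epsilon> * (cmod q2)\<^sup>2) = of_real (d\<^sub>1 \<epsilon>) * (c * q1) * cnj q1 + of_real (d\<^sub>2 \<epsilon>) * (c * q2) * cnj q2"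
      by (simp add: complex_norm_square algebra_simps del: of_real_power)
    also have "\<dots> = - (- of_real (d\<^sub>1 \<epsilon>) * (c * q1) * cnj q1 + - of_real (d\<^sub>2 \<epsilon>) * (c * q2) * cnj q2)"
      by simp
    also have "\<dots> = c * (- t)" using c(3) unfolding c(1,2) by simp
    finally have "of_real (d\<^sub>1 \<epsilon> * (cmod q1)\<^sup>2 + d\<^sub>2 \<epsilon> * (cmod q2)\<^sup>2) = - t"
      using \<open>c \<noteq> 0\<close> by (simp only: mult_cancel_left) simp
    then show ?case using c \<open>c \<noteq> 0\<close> by blast
  qed
  then show thesis by (rule rigid)
qed

text \<open>
  In the rigid case, eigenfunctions that vanish at the central end of the long edge satisfy \<open>d\<^sub>1 \<bar>q1\<bar>\<^sup>2 = - t\<close> with a constant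
  right-hand side. As \<open>d\<^sub>1\<close> tends to \<open>0\<close> the constant is \<open>0\<close>, but \<open>d\<^sub>1\<close> is positive.
\<close>

lemma rigid_short_only_impossible:
  fixes t :: complex
  assumes d0: "(d\<^sub>1 \<longlongrightarrow> 0) (at_right 0)"
    and rigid: "\<forall>\<^sub>F \<epsilon> in at_right 0. (\<exists>c. c \<noteq> 0 \<and> y \<epsilon> = c * q1 \<and> z \<epsilon> = 0) \<and> of_real (d\<^sub>1 \<epsilon> * (cmod q1)\<^sup>2) = - t"
  shows False
proof -
  have "((\<lambda>\<epsilon>. complex_of_real (d\<^sub>1 \<epsilon> * (cmod q1)\<^sup>2)) \<longlongrightarrow> of_real (0 * (cmod q1)\<^sup>2)) (at_right 0)"
    by (intro tendsto_intros d0)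
  moreover have "((\<lambda>\<epsilon>. complex_of_real (d\<^sub>1 \<epsilon> * (cmod q1)\<^sup>2)) \<longlongrightarrow> - t) (at_right 0)"
    using rigid by (intro tendsto_eventually) (auto elim: eventually_mono)
  ultimately have t: "- t = 0"
    using tendsto_unique[OF trivial_limit_at_right_real] by fastforce
  have "\<forall>\<^sub>F \<epsilon> in at_right 0. y \<epsilon> = 0 \<and> z \<epsilon> = 0"
    using rigid d\<^sub>1_pos by eventually_elim (auto simp only: t of_real_eq_0_iff mult_eq_0_iff, auto)
  then have "\<forall>\<^sub>F \<epsilon> in at_right (0::real). \<epsilon> \<noteq> \<epsilon>"
    using S E total by eventually_elim auto
  then show False by simp
qed

text \<open>
  Otherwise the left-hand side of the rigid equation would be unbounded.
\<close>

lemma rigid_edge_component_zero: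
  fixes t :: complex
  assumes d2: "filterlim d\<^sub>2 at_top (at_right 0)"
    and rigid: "\<forall>\<^sub>F \<epsilon> in at_right 0. of_real (d\<^sub>1 \<epsilon> * (cmod q1)\<^sup>2 + d\<^sub>2 \<epsilon> * (cmod q2)\<^sup>2) = - t"
  shows "q2 = 0"
proof (rule ccontr)
  assume "q2 \<noteq> 0"
  have "\<forall>\<^sub>F \<epsilon> in at_right 0. d\<^sub>2 \<epsilon> > cmod t / (cmod q2)\<^sup>2"
    using d2 by (auto simp: filterlim_at_top_dense)
  then have "\<forall>\<^sub>F \<epsilon> in at_right (0::real). \<epsilon> \<noteq> \<epsilon>"
    using rigid d\<^sub>1_pos
  proof eventually_elim
    case (elim \<epsilon>)
    have "cmod t < d\<^sub>2 \<epsilon> * (cmod q2)\<^sup>2"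
      using elim(1) \<open>q2 \<noteq> 0\<close> by (simp add: divide_less_eq)
    also have "\<dots> \<le> d\<^sub>1 \<epsilon> * (cmod q1)\<^sup>2 + d\<^sub>2 \<epsilon> * (cmod q2)\<^sup>2" using elim by simp
    also have "\<dots> \<le> cmod (of_real (d\<^sub>1 \<epsilon> * (cmod q1)\<^sup>2 + d\<^sub>2 \<epsilon> * (cmod q2)\<^sup>2))"
      by (simp only: norm_of_real abs_ge_self)
    also have "\<dots> = cmod t" unfolding elim(2) by simp
    finally show ?case by simp
  qed
  then show False by simp
qed

text \<open>
  The weight of the short edge is at most \<open>\<epsilon>\<close> and that of the long edge stays away from \<open>0\<close>. So it
  suffices that the value \<open>y\<close> on the short edge is bounded by a multiple of \<open>z\<close>, and this comes from
  the first vertex equation: as \<open>d\<^sub>1\<close> tends to \<open>0\<close>, it determines \<open>y\<close> by \<open>z\<close> unless \<open>t = 0\<close>. If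
  \<open>t = 0\<close>, eliminating \<open>z\<close> shows that \<open>y\<close> vanishes for small \<open>\<epsilon>\<close>. In the rigid case \<open>y\<close> is a fixed
  multiple of \<open>z\<close>, since \<open>q2\<close> cannot be zero.
\<close>

lemma bounded_wave_number:
  assumes "0 < c" and \<kappa>: "\<forall>\<^sub>F \<epsilon> in at_right 0. c \<le> \<kappa> \<epsilon> \<and> \<kappa> \<epsilon> \<le> C"
  shows "S \<in> O[at_right 0](\<lambda>\<epsilon>. \<epsilon>)" and "(\<lambda>\<epsilon>. E \<epsilon> - 1) \<in> O[at_right 0](\<lambda>\<epsilon>. \<epsilon>)"
proof -
  have "\<forall>\<^sub>F \<epsilon> in at_right (0::real). c \<le> C" using \<kappa> by eventually_elim linarith
  then have "c \<le> C" by simp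
  have id0: "((\<lambda>\<epsilon>::real. \<epsilon>) \<longlongrightarrow> 0) (at_right 0)" by (rule tendsto_ident_at)
  have d1_le: "\<forall>\<^sub>F \<epsilon> in at_right 0. d\<^sub>1 \<epsilon> \<le> C\<^sup>2 * \<epsilon>"
    using d\<^sub>1_le pos \<kappa>
  proof eventually_elim
    case (elim \<epsilon>)
    have "(\<kappa> \<epsilon>)\<^sup>2 * \<epsilon> \<le> C\<^sup>2 * \<epsilon>" using elim by (intro mult_right_mono power_mono) auto
    then show ?case using elim by linarith
  qed
  have d1_0: "(d\<^sub>1 \<longlongrightarrow> 0) (at_right 0)"
    using d\<^sub>1_pos
    by (intro tendsto_sandwich[OF _ d1_le tendsto_const tendsto_mult_right_zero[OF id0]]) (auto elim: eventually_mono)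
  have d2_le: "\<forall>\<^sub>F \<epsilon> in at_right 0. \<bar>s + d\<^sub>2 \<epsilon>\<bar> \<le> \<bar>s\<bar> + C / tanh c" for s
    using \<kappa> pos
  proof eventually_elim
    case (elim \<epsilon>)
    have "tanh c > 0" "tanh c \<le> tanh (\<kappa> \<epsilon>)" using \<open>0 < c\<close> elim by auto
    then have "d\<^sub>2 \<epsilon> \<le> C / tanh c" "0 \<le> d\<^sub>2 \<epsilon>"
      unfolding d\<^sub>2_def using elim \<open>0 < c\<close> by (auto intro!: frac_le)
    then show ?case by linarith
  qed
  have "continuous_on {c..C} edge_weight"
    unfolding edge_weight_def using \<open>0 < c\<close> by (intro continuous_intros) (auto simp: cosh_real_nonzero)
  then obtain k where k: "k \<in> {c..C}" "\<And>k'. k' \<in> {c..C} \<Longrightarrow> edge_weight k \<le> edge_weight k'"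
    using continuous_attains_inf[of "{c..C}" edge_weight] \<open>c \<le> C\<close> by auto
  define m where "m = edge_weight k"
  have "m > 0" using k \<open>0 < c\<close> by (simp add: m_def edge_weight_pos)
  obtain K where K: "\<forall>\<^sub>F \<epsilon> in at_right 0. cmod (y \<epsilon>) \<le> K * cmod (z \<epsilon>)"
  proof (cases rule: coupling_cases)
    case (coupled t s b)
    show thesis
    proof (cases "t = 0")
      case False
      have "\<forall>\<^sub>F \<epsilon> in at_right 0. d\<^sub>1 \<epsilon> < \<bar>t\<bar> / 2"
        using False by (intro order_tendstoD[OF d1_0]) auto
      then have "\<forall>\<^sub>F \<epsilon> in at_right 0. cmod (y \<epsilon>) \<le> 2 * cmod b / \<bar>t\<bar> * cmod (z \<epsilon>)"
        using coupled d\<^sub>1_pos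
      proof eventually_elim
        case (elim \<epsilon>)
        have "\<bar>t\<bar> / 2 \<le> \<bar>t + d\<^sub>1 \<epsilon>\<bar>"
          using elim(1,3) by linarith
        then have "\<bar>t\<bar> / 2 * cmod (y \<epsilon>) \<le> \<bar>t + d\<^sub>1 \<epsilon>\<bar> * cmod (y \<epsilon>)"
          by (rule mult_right_mono) simp
        also have "\<dots> = cmod (of_real (t + d\<^sub>1 \<epsilon>) * y \<epsilon>)" by (simp only: norm_mult norm_of_real)
        also have "\<dots> = cmod b * cmod (z \<epsilon>)" using elim by (simp add: norm_mult)
        finally show ?case using False by (simp add: field_simps)
      qed
      then show thesis by (rule that)
    next
      case True
      have "\<forall>\<^sub>F \<epsilon> in at_right 0. norm (d\<^sub>1 \<epsilon> * (s + d\<^sub>2 \<epsilon>)) \<le> d\<^sub>1 \<epsilon> * (\<bar>s\<bar> + C / tanh c)"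
        using d2_le[of s] d\<^sub>1_pos by eventually_elim (auto simp: abs_mult)
      then have lim: "((\<lambda>\<epsilon>. d\<^sub>1 \<epsilon> * (s + d\<^sub>2 \<epsilon>)) \<longlongrightarrow> 0) (at_right 0)"
        by (rule Lim_null_comparison) (intro tendsto_mult_left_zero d1_0)
      have "\<forall>\<^sub>F \<epsilon> in at_right 0. y \<epsilon> = 0"
      proof (cases "b = 0")
        case True
        show ?thesis
          using coupled d\<^sub>1_pos by eventually_elim (use \<open>t = 0\<close> \<open>b = 0\<close> in auto)
      next
        case False
        have "\<forall>\<^sub>F \<epsilon> in at_right 0. d\<^sub>1 \<epsilon> * (s + d\<^sub>2 \<epsilon>) < (cmod b)\<^sup>2"
          using False by (intro order_tendstoD[OF lim]) auto
        then show ?thesis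
          using coupled
        proof eventually_elim
          case (elim \<epsilon>)
          \<comment> \<open>A nonzero \<open>y\<close> would make the determinant of the two vertex equations vanish.\<close>
          have "of_real (d\<^sub>1 \<epsilon> * (s + d\<^sub>2 \<epsilon>)) * y \<epsilon> = of_real (s + d\<^sub>2 \<epsilon>) * (of_real (t + d\<^sub>1 \<epsilon>) * y \<epsilon>)"
            using \<open>t = 0\<close> by (simp add: algebra_simps)
          also have "\<dots> = - b * (of_real (s + d\<^sub>2 \<epsilon>) * z \<epsilon>)" using elim by (simp only: mult.left_commute)
          also have "\<dots> = (b * cnj b) * y \<epsilon>" using elim by (simp add: algebra_simps)
          also have "\<dots> = of_real ((cmod b)\<^sup>2) * y \<epsilon>" by (simp only: complex_norm_square)
          finally have "y \<epsilon> = 0 \<or> d\<^sub>1 \<epsilon> * (s + d\<^sub>2 \<epsilon>) = (cmod b)\<^sup>2"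
            by (simp only: mult_cancel_right of_real_eq_iff)
          then show ?case using elim by auto
        qed
      qed
      then have "\<forall>\<^sub>F \<epsilon> in at_right 0. cmod (y \<epsilon>) \<le> 0 * cmod (z \<epsilon>)"
        by eventually_elim simp
      then show thesis by (rule that)
    qed
  next
    case (rigid q1 q2 t)
    have "q2 \<noteq> 0"
    proof
      assume "q2 = 0"
      show False
        by (rule rigid_short_only_impossible[OF d1_0, of q1 t])
           (use rigid in \<open>eventually_elim, auto simp: \<open>q2 = 0\<close>\<close>)
    qed
    have "\<forall>\<^sub>F \<epsilon> in at_right 0. cmod (y \<epsilon>) \<le> cmod q1 / cmod q2 * cmod (z \<epsilon>)"
      using rigid by eventually_elim (use \<open>q2 \<noteq> 0\<close> in \<open>auto simp: norm_mult\<close>)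
    then show thesis by (rule that)
  qed
  have bound: "\<forall>\<^sub>F \<epsilon> in at_right 0. norm (S \<epsilon>) \<le> K\<^sup>2 / m * norm \<epsilon>"
    using K S E total nonneg pos \<kappa>
  proof eventually_elim
    case (elim \<epsilon>)
    have "(cmod (z \<epsilon>))\<^sup>2 * m \<le> E \<epsilon>"
      unfolding elim(3) m_def using k(2)[of "\<kappa> \<epsilon>"] elim by (intro mult_left_mono) auto
    then have z: "(cmod (z \<epsilon>))\<^sup>2 \<le> 1 / m"
      using elim \<open>m > 0\<close> by (simp add: field_simps)
    have "(cmod (y \<epsilon>))\<^sup>2 \<le> K\<^sup>2 * (cmod (z \<epsilon>))\<^sup>2"
      using power_mono[OF elim(1), of 2] by (simp add: power_mult_distrib)
    also have "\<dots> \<le> K\<^sup>2 * (1 / m)"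
      using z by (intro mult_left_mono) auto
    finally have "S \<epsilon> \<le> K\<^sup>2 * (1 / m) * \<epsilon>"
      unfolding elim(2) using elim \<open>m > 0\<close>
      by (intro mult_mono short_weight_le less_imp_le[OF short_weight_pos]) auto
    then show ?case using elim by simp
  qed
  then show "S \<in> O[at_right 0](\<lambda>\<epsilon>. \<epsilon>)" by (rule bigoI)
  have "\<forall>\<^sub>F \<epsilon> in at_right 0. norm (E \<epsilon> - 1) \<le> K\<^sup>2 / m * norm \<epsilon>"
    using bound total nonneg by eventually_elim auto
  then show "(\<lambda>\<epsilon>. E \<epsilon> - 1) \<in> O[at_right 0](\<lambda>\<epsilon>. \<epsilon>)" by (rule bigoI)
qed

lemma large_wave_number:
  assumes "0 < c" "0 < p" and \<kappa>: "\<forall>\<^sub>F \<epsilon> in at_right 0. c * \<epsilon> powr (- p) \<le> \<kappa> \<epsilon>"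
  shows "filterlim \<kappa> at_top (at_right 0)" and "filterlim d\<^sub>2 at_top (at_right 0)"
proof -
  have "filterlim (\<lambda>\<epsilon>. c * \<epsilon> powr (- p)) at_top (at_right 0)"
    using assms(1,2) by real_asymp
  then show lim: "filterlim \<kappa> at_top (at_right 0)"
    by (rule filterlim_at_top_mono) (rule \<kappa>)
  then show "filterlim d\<^sub>2 at_top (at_right 0)"
    by (rule filterlim_at_top_mono) (rule d\<^sub>2_ge)
qed

lemma slow_on_short_edge:
  assumes "p < 1" and \<kappa>: "\<forall>\<^sub>F \<epsilon> in at_right 0. \<kappa> \<epsilon> \<le> C * \<epsilon> powr (- p)"
  shows "filterlim (\<lambda>\<epsilon>. \<kappa> \<epsilon> * \<epsilon>) (at_right 0) (at_right 0)"
proof -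
  have le: "\<forall>\<^sub>F \<epsilon> in at_right 0. \<kappa> \<epsilon> * \<epsilon> \<le> C * \<epsilon> powr (- p) * \<epsilon>"
    using \<kappa> pos by eventually_elim (auto intro: mult_right_mono)
  have "((\<lambda>\<epsilon>::real. \<epsilon> powr (1 - p)) \<longlongrightarrow> 0) (at_right 0)"
    using \<open>p < 1\<close> by real_asymp
  then have "((\<lambda>\<epsilon>::real. C * \<epsilon> powr (1 - p)) \<longlongrightarrow> 0) (at_right 0)"
    by (rule tendsto_mult_right_zero)
  moreover have "\<forall>\<^sub>F \<epsilon>::real in at_right 0. C * \<epsilon> powr (1 - p) = C * \<epsilon> powr (- p) * \<epsilon>"
    using eventually_at_right_less[of 0] by eventually_elim (simp add: powr_diff powr_minus field_simps)
  ultimately have "((\<lambda>\<epsilon>. C * \<epsilon> powr (- p) * \<epsilon>) \<longlongrightarrow> 0) (at_right 0)"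
    by (rule Lim_transform_eventually)
  then have "((\<lambda>\<epsilon>. \<kappa> \<epsilon> * \<epsilon>) \<longlongrightarrow> 0) (at_right 0)"
    using pos by (intro tendsto_sandwich[OF _ le tendsto_const]) (auto elim: eventually_mono)
  then show ?thesis
    using pos by (auto simp: filterlim_at elim: eventually_mono)
qed

text \<open>
  The derivative ratio \<open>d\<^sub>2 \<ge> \<kappa>\<close> on the long edge forces \<open>z = O(y / \<kappa>)\<close>. The weight of the long edge is
  of order \<open>1 / \<kappa>\<close> and that of the short edge of order \<open>\<epsilon>\<close>, so the long edge carries the part
  \<open>O(1 / (\<kappa>\<^sup>3 \<epsilon>))\<close> of the squared norm. In the rigid case \<open>z\<close> even vanishes.
\<close>

lemma wave_number_of_order_half:
  assumes "0 < c"
    and \<kappa>: "\<forall>\<^sub>F \<epsilon> in at_right 0. c * \<epsilon> powr (- (1/2)) \<le> \<kappa> \<epsilon> \<and> \<kappa> \<epsilon> \<le> C * \<epsilon> powr (- (1/2))"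
  shows "(\<lambda>\<epsilon>. S \<epsilon> - 1) \<in> O[at_right 0](\<lambda>\<epsilon>. \<epsilon> powr (1/2))" and "E \<in> O[at_right 0](\<lambda>\<epsilon>. \<epsilon> powr (1/2))"
proof -
  have lower: "\<forall>\<^sub>F \<epsilon> in at_right 0. c * \<epsilon> powr (- (1/2)) \<le> \<kappa> \<epsilon>"
    and upper: "\<forall>\<^sub>F \<epsilon> in at_right 0. \<kappa> \<epsilon> \<le> C * \<epsilon> powr (- (1/2))"
    using \<kappa> by (auto elim: eventually_mono)
  note top = large_wave_number[OF \<open>0 < c\<close> _ lower, simplified]
  note short = slow_on_short_edge[OF _ upper, simplified]
  obtain K where K: "\<forall>\<^sub>F \<epsilon> in at_right 0. norm (E \<epsilon>) \<le> K * norm (\<epsilon> powr (1/2))"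
  proof (cases rule: coupling_cases)
    case (coupled t s b)
    have "\<forall>\<^sub>F \<epsilon> in at_right 0. 2 * \<bar>s\<bar> \<le> \<kappa> \<epsilon>"
      using top(1) by (simp add: filterlim_at_top)
    moreover have "\<forall>\<^sub>F \<epsilon> in at_right 0. 1 / 2 \<le> tanh (\<kappa> \<epsilon>)"
      using tanh_lower_at_top top(1) by (rule eventually_compose_filterlim)
    moreover have "\<forall>\<^sub>F \<epsilon> in at_right 0. \<kappa> \<epsilon> * \<epsilon> / 2 \<le> tanh (\<kappa> \<epsilon> * \<epsilon>)"
      using tanh_lower_at_0 short by (rule eventually_compose_filterlim)
    ultimately have "\<forall>\<^sub>F \<epsilon> in at_right 0. norm (E \<epsilon>) \<le> 16 * (cmod b)\<^sup>2 / c ^ 3 * norm (\<epsilon> powr (1/2))"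
      using coupled d\<^sub>2_ge pos S E total nonneg lower
    proof eventually_elim
      case (elim \<epsilon>)
      have \<epsilon>: "0 < \<epsilon>" and k: "0 < \<kappa> \<epsilon>" using elim by auto
      have sd: "\<kappa> \<epsilon> / 2 \<le> s + d\<^sub>2 \<epsilon>" using elim(1,5) by linarith
      have "\<kappa> \<epsilon> / 2 * cmod (z \<epsilon>) \<le> \<bar>s + d\<^sub>2 \<epsilon>\<bar> * cmod (z \<epsilon>)"
        using order_trans[OF sd abs_ge_self] by (rule mult_right_mono) simp
      also have "\<dots> = cmod (of_real (s + d\<^sub>2 \<epsilon>) * z \<epsilon>)" by (simp only: norm_mult norm_of_real)
      also have "\<dots> = cmod b * cmod (y \<epsilon>)" using elim by (simp add: norm_mult)
      finally have "cmod (z \<epsilon>) \<le> 2 * cmod b * cmod (y \<epsilon>) / \<kappa> \<epsilon>"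
        using k by (simp add: field_simps)
      then have "(cmod (z \<epsilon>))\<^sup>2 \<le> (2 * cmod b * cmod (y \<epsilon>) / \<kappa> \<epsilon>)\<^sup>2"
        by (rule power_mono) simp
      then have z: "(cmod (z \<epsilon>))\<^sup>2 \<le> 4 * (cmod b)\<^sup>2 * (cmod (y \<epsilon>))\<^sup>2 / (\<kappa> \<epsilon>)\<^sup>2"
        by (simp add: power_mult_distrib power_divide)
      have "\<kappa> \<epsilon> * \<epsilon> / 2 / (2 * \<kappa> \<epsilon>) \<le> tanh (\<kappa> \<epsilon> * \<epsilon>) / (2 * \<kappa> \<epsilon>)"
        using elim(3) k by (intro divide_right_mono) auto
      also have "\<dots> \<le> short_weight \<epsilon> (\<kappa> \<epsilon>)"
        using \<epsilon> by (simp add: short_weight_def)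
      finally have "\<epsilon> / 4 \<le> short_weight \<epsilon> (\<kappa> \<epsilon>)" using k by simp
      then have "(cmod (y \<epsilon>))\<^sup>2 * (\<epsilon> / 4) \<le> S \<epsilon>"
        unfolding elim(7) by (intro mult_left_mono) auto
      then have "(cmod (y \<epsilon>))\<^sup>2 * (\<epsilon> / 4) \<le> 1" using elim(9,10) by linarith
      then have y: "(cmod (y \<epsilon>))\<^sup>2 \<le> 4 / \<epsilon>" using \<epsilon> by (simp add: field_simps)
      have "edge_weight (\<kappa> \<epsilon>) \<le> 1 / (2 * \<kappa> \<epsilon> * tanh (\<kappa> \<epsilon>))"
        by (simp add: edge_weight_def)
      also have "\<dots> \<le> 1 / (2 * \<kappa> \<epsilon> * (1 / 2))"
        using elim(2) k by (intro divide_left_mono mult_left_mono) auto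
      finally have w: "edge_weight (\<kappa> \<epsilon>) \<le> 1 / \<kappa> \<epsilon>" by simp
      have "E \<epsilon> \<le> 4 * (cmod b)\<^sup>2 * (cmod (y \<epsilon>))\<^sup>2 / (\<kappa> \<epsilon>)\<^sup>2 * (1 / \<kappa> \<epsilon>)"
        unfolding elim(8) using z w k by (intro mult_mono less_imp_le[OF edge_weight_pos]) auto
      also have "\<dots> \<le> 4 * (cmod b)\<^sup>2 * (4 / \<epsilon>) / (\<kappa> \<epsilon>)\<^sup>2 * (1 / \<kappa> \<epsilon>)"
        using y k by (intro mult_right_mono divide_right_mono mult_left_mono) auto
      also have "\<dots> = 16 * (cmod b)\<^sup>2 / (\<kappa> \<epsilon> ^ 3 * \<epsilon>)"
        by (simp add: power2_eq_square power3_eq_cube)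
      also have "\<dots> \<le> 16 * (cmod b)\<^sup>2 / ((c * \<epsilon> powr (- (1/2))) ^ 3 * \<epsilon>)"
        using elim(11) \<epsilon> k \<open>0 < c\<close>
        by (intro divide_left_mono mult_right_mono power_mono mult_pos_pos zero_less_power) auto
      also have "(c * \<epsilon> powr (- (1/2))) ^ 3 * \<epsilon> = c ^ 3 * \<epsilon> powr (- (1/2))"
      proof -
        have "(\<epsilon> powr (- (1/2))) ^ 3 * \<epsilon> = \<epsilon> powr (- (3/2)) * \<epsilon> powr 1"
          using \<epsilon> by (simp add: powr_power)
        also have "\<dots> = \<epsilon> powr (- (1/2))" by (subst powr_add[symmetric]) simp
        finally show ?thesis by (simp add: power_mult_distrib)
      qed
      also have "16 * (cmod b)\<^sup>2 / (c ^ 3 * \<epsilon> powr (- (1/2))) = 16 * (cmod b)\<^sup>2 / c ^ 3 * \<epsilon> powr (1/2)"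
        using \<epsilon> by (simp add: powr_minus field_simps)
      finally show ?case using elim(10) by simp
    qed
    then show thesis by (rule that)
  next
    case (rigid q1 q2 t)
    have "\<forall>\<^sub>F \<epsilon> in at_right 0. of_real (d\<^sub>1 \<epsilon> * (cmod q1)\<^sup>2 + d\<^sub>2 \<epsilon> * (cmod q2)\<^sup>2) = - t"
      using rigid by eventually_elim blast
    then have "q2 = 0"
      by (rule rigid_edge_component_zero[OF top(2)])
    have "\<forall>\<^sub>F \<epsilon> in at_right 0. norm (E \<epsilon>) \<le> 0 * norm (\<epsilon> powr (1/2))"
      using rigid E by eventually_elim (auto simp: \<open>q2 = 0\<close>)
    then show thesis by (rule that)
  qed
  then show "E \<in> O[at_right 0](\<lambda>\<epsilon>. \<epsilon> powr (1/2))" by (rule bigoI)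
  have "\<forall>\<^sub>F \<epsilon> in at_right 0. norm (S \<epsilon> - 1) \<le> K * norm (\<epsilon> powr (1/2))"
    using K total
  proof eventually_elim
    case (elim \<epsilon>)
    then have "S \<epsilon> - 1 = - E \<epsilon>" by simp
    then show ?case using elim by simp
  qed
  then show "(\<lambda>\<epsilon>. S \<epsilon> - 1) \<in> O[at_right 0](\<lambda>\<epsilon>. \<epsilon> powr (1/2))" by (rule bigoI)
qed

text \<open>
  Now \<open>d\<^sub>1\<close> tends to \<open>0\<close> and \<open>d\<^sub>2\<close> to infinity. This excludes the rigid case, and the vanishing
  determinant \<open>(t + d\<^sub>1) (s + d\<^sub>2) = \<bar>b\<bar>\<^sup>2\<close> of the vertex equations forces \<open>t = 0\<close>, so that
  \<open>d\<^sub>1 (s + d\<^sub>2) = \<bar>b\<bar>\<^sup>2\<close>. Therefore \<open>\<bar>z\<bar>\<^sup>2 / \<bar>y\<bar>\<^sup>2 = d\<^sub>1 / (s + d\<^sub>2)\<close>, and the constant \<open>b\<close> drops out of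
  the ratio \<open>E / S\<close>. What remains is a function of \<open>\<kappa> \<epsilon>\<close> tending to \<open>1\<close> times a function of \<open>\<kappa>\<close> tending to
  \<open>1/2\<close>; as \<open>S + E = 1\<close>, this gives \<open>2/3\<close> and \<open>1/3\<close>.
\<close>

lemma wave_number_of_order_third:
  assumes "0 < c" "0 < C"
    and \<kappa>: "\<forall>\<^sub>F \<epsilon> in at_right 0. c * \<epsilon> powr (- (1/3)) \<le> \<kappa> \<epsilon> \<and> \<kappa> \<epsilon> \<le> C * \<epsilon> powr (- (1/3))"
  shows "(\<lambda>\<epsilon>. S \<epsilon> - 2/3) \<in> O[at_right 0](\<lambda>\<epsilon>. \<epsilon> powr (1/3))" and "(\<lambda>\<epsilon>. E \<epsilon> - 1/3) \<in> O[at_right 0](\<lambda>\<epsilon>. \<epsilon> powr (1/3))"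
proof -
  have lower: "\<forall>\<^sub>F \<epsilon> in at_right 0. c * \<epsilon> powr (- (1/3)) \<le> \<kappa> \<epsilon>"
    and upper: "\<forall>\<^sub>F \<epsilon> in at_right 0. \<kappa> \<epsilon> \<le> C * \<epsilon> powr (- (1/3))"
    using \<kappa> by (auto elim: eventually_mono)
  note top = large_wave_number[OF \<open>0 < c\<close> _ lower, simplified]
  note short = slow_on_short_edge[OF _ upper, simplified]
  have d1_0: "(d\<^sub>1 \<longlongrightarrow> 0) (at_right 0)"
  proof (rule d\<^sub>1_tendsto_0)
    have nonneg: "\<forall>\<^sub>F \<epsilon> in at_right 0. 0 \<le> (\<kappa> \<epsilon>)\<^sup>2 * \<epsilon>"
      using pos by eventually_elim simp
    have le: "\<forall>\<^sub>F \<epsilon> in at_right 0. (\<kappa> \<epsilon>)\<^sup>2 * \<epsilon> \<le> (C * \<epsilon> powr (- (1/3)))\<^sup>2 * \<epsilon>"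
      using upper pos by eventually_elim (auto intro!: mult_right_mono power_mono)
    have "((\<lambda>\<epsilon>. (C * \<epsilon> powr (- (1/3)))\<^sup>2 * \<epsilon>) \<longlongrightarrow> 0) (at_right 0)"
      using \<open>0 < C\<close> by real_asymp
    then show "((\<lambda>\<epsilon>. (\<kappa> \<epsilon>)\<^sup>2 * \<epsilon>) \<longlongrightarrow> 0) (at_right 0)"
      by (rule tendsto_sandwich[OF nonneg le tendsto_const])
  qed
  obtain t s b where coupled: "\<forall>\<^sub>F \<epsilon> in at_right 0. of_real (t + d\<^sub>1 \<epsilon>) * y \<epsilon> = - b * z \<epsilon> \<and> of_real (s + d\<^sub>2 \<epsilon>) * z \<epsilon> = - cnj b * y \<epsilon>"
  proof (cases rule: coupling_cases)
    case (coupled t s b)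
    then show thesis by (rule that)
  next
    case (rigid q1 q2 t)
    have "\<forall>\<^sub>F \<epsilon> in at_right 0. of_real (d\<^sub>1 \<epsilon> * (cmod q1)\<^sup>2 + d\<^sub>2 \<epsilon> * (cmod q2)\<^sup>2) = - t"
      using rigid by eventually_elim blast
    then have "q2 = 0"
      by (rule rigid_edge_component_zero[OF top(2)])
    have False
      by (rule rigid_short_only_impossible[OF d1_0, of q1 t])
         (use rigid in \<open>eventually_elim, auto simp: \<open>q2 = 0\<close>\<close>)
    then show thesis ..
  qed
  have sd_top: "filterlim (\<lambda>\<epsilon>. s + d\<^sub>2 \<epsilon>) at_top (at_right 0)"
    by (intro filterlim_tendsto_add_at_top[OF tendsto_const] top(2))
  then have sd_pos: "\<forall>\<^sub>F \<epsilon> in at_right 0. 0 < s + d\<^sub>2 \<epsilon>"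
    by (simp add: filterlim_at_top_dense)
  have y: "\<forall>\<^sub>F \<epsilon> in at_right 0. y \<epsilon> \<noteq> 0"
    using coupled sd_pos S E total
  proof eventually_elim
    case (elim \<epsilon>)
    show ?case
    proof
      assume y: "y \<epsilon> = 0"
      then have "of_real (s + d\<^sub>2 \<epsilon>) * z \<epsilon> = 0" using elim(1) by simp
      then have "z \<epsilon> = 0" using elim(2) by (simp only: mult_eq_0_iff of_real_eq_0_iff) auto
      then show False using y elim(3,4,5) by simp
    qed
  qed
  have dispersion: "\<forall>\<^sub>F \<epsilon> in at_right 0. (t + d\<^sub>1 \<epsilon>) * (s + d\<^sub>2 \<epsilon>) = (cmod b)\<^sup>2"
    using coupled y
  proof eventually_elim
    case (elim \<epsilon>)
    have "of_real ((t + d\<^sub>1 \<epsilon>) * (s + d\<^sub>2 \<epsilon>)) * y \<epsilon> = of_real (s + d\<^sub>2 \<epsilon>) * (of_real (t + d\<^sub>1 \<epsilon>) * y \<epsilon>)"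
      by (simp add: algebra_simps)
    also have "\<dots> = - b * (of_real (s + d\<^sub>2 \<epsilon>) * z \<epsilon>)" using elim by (simp only: mult.left_commute)
    also have "\<dots> = (b * cnj b) * y \<epsilon>" using elim by (simp add: algebra_simps)
    also have "\<dots> = of_real ((cmod b)\<^sup>2) * y \<epsilon>" by (simp only: complex_norm_square)
    finally show ?case using elim(2) by (simp only: mult_cancel_right of_real_eq_iff) simp
  qed
  have "t = 0"
  proof -
    have "((\<lambda>\<epsilon>. (cmod b)\<^sup>2 / (s + d\<^sub>2 \<epsilon>)) \<longlongrightarrow> 0) (at_right 0)"
      by (rule tendsto_divide_0[OF tendsto_const]) (rule filterlim_at_top_imp_at_infinity[OF sd_top])
    moreover have "\<forall>\<^sub>F \<epsilon> in at_right 0. (cmod b)\<^sup>2 / (s + d\<^sub>2 \<epsilon>) = t + d\<^sub>1 \<epsilon>"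
      using dispersion sd_pos by eventually_elim (simp add: field_simps)
    ultimately have "((\<lambda>\<epsilon>. t + d\<^sub>1 \<epsilon>) \<longlongrightarrow> 0) (at_right 0)"
      by (rule Lim_transform_eventually)
    moreover have "((\<lambda>\<epsilon>. t + d\<^sub>1 \<epsilon>) \<longlongrightarrow> t + 0) (at_right 0)"
      by (intro tendsto_intros d1_0)
    ultimately show "t = 0"
      using tendsto_unique[OF trivial_limit_at_right_real] by fastforce
  qed
  \<comment> \<open>\<open>F\<close> collects \<open>d\<^sub>1 / (\<kappa>\<^sup>2 \<epsilon>)\<close> and the short weight divided by \<open>\<epsilon>\<close>; the powers of \<open>\<epsilon>\<close> cancel and
    the factor \<open>\<kappa>\<^sup>2\<close> moves to \<open>G\<close>.\<close>
  define F where "F y = tanh y / y / (1 / (2 * (cosh y)\<^sup>2) + tanh y / (2 * y))" for y :: real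
  define G where "G k = k\<^sup>2 * edge_weight k / (k / tanh k + s)" for k
  define R where "R \<epsilon> = F (\<kappa> \<epsilon> * \<epsilon>) * G (\<kappa> \<epsilon>)" for \<epsilon>
  have ratio: "\<forall>\<^sub>F \<epsilon> in at_right 0. E \<epsilon> = R \<epsilon> * S \<epsilon> \<and> 0 \<le> R \<epsilon>"
    using dispersion coupled sd_pos pos S E d\<^sub>1_pos
  proof eventually_elim
    case (elim \<epsilon>)
    have \<epsilon>: "0 < \<epsilon>" and k: "0 < \<kappa> \<epsilon>" using elim by auto
    have R: "R \<epsilon> = d\<^sub>1 \<epsilon> * edge_weight (\<kappa> \<epsilon>) / ((s + d\<^sub>2 \<epsilon>) * short_weight \<epsilon> (\<kappa> \<epsilon>))"
    proof -
      define n where "n = 1 / (2 * (cosh (\<kappa> \<epsilon> * \<epsilon>))\<^sup>2) + tanh (\<kappa> \<epsilon> * \<epsilon>) / (2 * (\<kappa> \<epsilon> * \<epsilon>))"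
      have n: "short_weight \<epsilon> (\<kappa> \<epsilon>) = \<epsilon> * n"
        using \<epsilon> k by (simp add: short_weight_def n_def distrib_left)
      have "R \<epsilon> = (tanh (\<kappa> \<epsilon> * \<epsilon>) / (\<kappa> \<epsilon> * \<epsilon>) / n) * ((\<kappa> \<epsilon>)\<^sup>2 * edge_weight (\<kappa> \<epsilon>) / (s + d\<^sub>2 \<epsilon>))"
        by (simp add: R_def F_def G_def n_def d\<^sub>2_def add.commute)
      also have "\<dots> = d\<^sub>1 \<epsilon> * edge_weight (\<kappa> \<epsilon>) / ((s + d\<^sub>2 \<epsilon>) * (\<epsilon> * n))"
        using \<epsilon> k by (simp add: d\<^sub>1_def power2_eq_square mult_ac)
      finally show ?thesis by (simp add: n)
    qed
    note w = short_weight_pos[OF \<epsilon> k] edge_weight_pos[OF k]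
    have "(s + d\<^sub>2 \<epsilon>) * cmod (z \<epsilon>) = cmod (of_real (s + d\<^sub>2 \<epsilon>) * z \<epsilon>)"
      using elim(3) by (simp add: norm_mult del: of_real_add)
    also have "\<dots> = cmod b * cmod (y \<epsilon>)" using elim(2) by (simp add: norm_mult)
    finally have "((s + d\<^sub>2 \<epsilon>) * cmod (z \<epsilon>))\<^sup>2 = (cmod b * cmod (y \<epsilon>))\<^sup>2" by simp
    then have "(s + d\<^sub>2 \<epsilon>) * ((s + d\<^sub>2 \<epsilon>) * (cmod (z \<epsilon>))\<^sup>2) = (cmod b)\<^sup>2 * (cmod (y \<epsilon>))\<^sup>2"
      by (simp add: power2_eq_square algebra_simps)
    also have "\<dots> = (s + d\<^sub>2 \<epsilon>) * (d\<^sub>1 \<epsilon> * (cmod (y \<epsilon>))\<^sup>2)"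
      using elim(1) \<open>t = 0\<close> by (simp add: mult_ac)
    finally have "(s + d\<^sub>2 \<epsilon>) * (cmod (z \<epsilon>))\<^sup>2 = d\<^sub>1 \<epsilon> * (cmod (y \<epsilon>))\<^sup>2"
      using elim(3) by (simp only: mult_cancel_left) simp
    then have z: "(cmod (z \<epsilon>))\<^sup>2 = d\<^sub>1 \<epsilon> * (cmod (y \<epsilon>))\<^sup>2 / (s + d\<^sub>2 \<epsilon>)"
      using elim(3) by (simp add: nonzero_eq_divide_eq mult.commute)
    have "E \<epsilon> = R \<epsilon> * S \<epsilon>"
      unfolding elim(5,6) z R using w by simp
    moreover have "0 \<le> R \<epsilon>"
      unfolding R using w elim by simp
    ultimately show ?case by blast
  qed
  have F: "(\<lambda>\<epsilon>. F (\<kappa> \<epsilon> * \<epsilon>) - 1) \<in> O[at_right 0](\<lambda>\<epsilon>. \<epsilon> powr (1/3))"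
  proof -
    have "(\<lambda>\<epsilon>. F (\<kappa> \<epsilon> * \<epsilon>) - 1) \<in> O[at_right 0](\<lambda>\<epsilon>. \<kappa> \<epsilon> * \<epsilon>)"
      using landau_o.big.compose[OF weight_quotient short] by (simp add: F_def)
    also have "(\<lambda>\<epsilon>. \<kappa> \<epsilon> * \<epsilon>) \<in> O[at_right 0](\<lambda>\<epsilon>. \<epsilon> powr (- (1/3)) * \<epsilon>)"
    proof (rule bigoI)
      show "\<forall>\<^sub>F \<epsilon> in at_right 0. norm (\<kappa> \<epsilon> * \<epsilon>) \<le> C * norm (\<epsilon> powr (- (1/3)) * \<epsilon>)"
        using upper pos by eventually_elim (auto simp: abs_mult mult.assoc[symmetric] intro!: mult_right_mono)
    qed
    also have "(\<lambda>\<epsilon>. \<epsilon> powr (- (1/3)) * \<epsilon>) \<in> O[at_right 0](\<lambda>\<epsilon>::real. \<epsilon> powr (1/3))"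
      by real_asymp
    finally show ?thesis .
  qed
  have G: "(\<lambda>\<epsilon>. G (\<kappa> \<epsilon>) - 1/2) \<in> O[at_right 0](\<lambda>\<epsilon>. \<epsilon> powr (1/3))"
  proof -
    have "(\<lambda>\<epsilon>. G (\<kappa> \<epsilon>) - 1/2) \<in> O[at_right 0](\<lambda>\<epsilon>. 1 / \<kappa> \<epsilon>)"
      using landau_o.big.compose[OF edge_factor top(1)] by (simp add: G_def)
    also have "(\<lambda>\<epsilon>. 1 / \<kappa> \<epsilon>) \<in> O[at_right 0](\<lambda>\<epsilon>. \<epsilon> powr (1/3))"
    proof (rule bigoI)
      show "\<forall>\<^sub>F \<epsilon> in at_right 0. norm (1 / \<kappa> \<epsilon>) \<le> 1 / c * norm (\<epsilon> powr (1/3))"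
        using lower pos
      proof eventually_elim
        case (elim \<epsilon>)
        have "1 / \<kappa> \<epsilon> \<le> 1 / (c * \<epsilon> powr (- (1/3)))"
          using elim \<open>0 < c\<close> by (intro divide_left_mono) auto
        then show ?case using elim by (simp add: powr_minus field_simps)
      qed
    qed
    finally show ?thesis .
  qed
  have R: "(\<lambda>\<epsilon>. R \<epsilon> - 1/2) \<in> O[at_right 0](\<lambda>\<epsilon>. \<epsilon> powr (1/3))"
  proof -
    have "(\<lambda>\<epsilon>::real. \<epsilon> powr (1/3)) \<in> O[at_right 0](\<lambda>_. 1)" by real_asymp
    then have "(\<lambda>\<epsilon>. G (\<kappa> \<epsilon>) - 1/2) \<in> O[at_right 0](\<lambda>_. 1)"
      using G landau_o.big_trans by blast
    from landau_o.big.mult[OF F this]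
    have FG: "(\<lambda>\<epsilon>. (F (\<kappa> \<epsilon> * \<epsilon>) - 1) * (G (\<kappa> \<epsilon>) - 1/2)) \<in> O[at_right 0](\<lambda>\<epsilon>. \<epsilon> powr (1/3))" by simp
    have half: "(\<lambda>\<epsilon>. 1/2 * (F (\<kappa> \<epsilon> * \<epsilon>) - 1)) \<in> O[at_right 0](\<lambda>\<epsilon>. \<epsilon> powr (1/3))"
      using F by simp
    have "(\<lambda>\<epsilon>. (F (\<kappa> \<epsilon> * \<epsilon>) - 1) * (G (\<kappa> \<epsilon>) - 1/2) + 1/2 * (F (\<kappa> \<epsilon> * \<epsilon>) - 1) + (G (\<kappa> \<epsilon>) - 1/2))
        \<in> O[at_right 0](\<lambda>\<epsilon>. \<epsilon> powr (1/3))"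
      by (rule sum_in_bigo(1)[OF sum_in_bigo(1)[OF FG half] G])
    also have "(\<lambda>\<epsilon>. (F (\<kappa> \<epsilon> * \<epsilon>) - 1) * (G (\<kappa> \<epsilon>) - 1/2) + 1/2 * (F (\<kappa> \<epsilon> * \<epsilon>) - 1) + (G (\<kappa> \<epsilon>) - 1/2)) = (\<lambda>\<epsilon>. R \<epsilon> - 1/2)"
      by (simp add: R_def algebra_simps)
    finally show ?thesis .
  qed
  have near: "\<forall>\<^sub>F \<epsilon> in at_right 0. \<bar>S \<epsilon> - 2/3\<bar> \<le> \<bar>R \<epsilon> - 1/2\<bar>"
    using ratio total
  proof eventually_elim
    case (elim \<epsilon>)
    \<comment> \<open>The map \<open>r \<mapsto> 1 / (1 + r)\<close> takes \<open>1/2\<close> to \<open>2/3\<close> and does not increase distances for \<open>r \<ge> 0\<close>.\<close>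
    have "S \<epsilon> * (1 + R \<epsilon>) = 1" using elim by (simp add: algebra_simps)
    then have "S \<epsilon> = 1 / (1 + R \<epsilon>)" using elim by (simp add: field_simps)
    then have "S \<epsilon> - 2/3 = - (2 / (3 * (1 + R \<epsilon>))) * (R \<epsilon> - 1/2)"
      using elim by (simp add: field_simps)
    then have "\<bar>S \<epsilon> - 2/3\<bar> = \<bar>- (2 / (3 * (1 + R \<epsilon>)))\<bar> * \<bar>R \<epsilon> - 1/2\<bar>"
      by (simp only: abs_mult)
    also have "\<dots> \<le> 1 * \<bar>R \<epsilon> - 1/2\<bar>"
    proof (rule mult_right_mono)
      have "\<bar>- (2 / (3 * (1 + R \<epsilon>)))\<bar> = 2 / (3 * (1 + R \<epsilon>))" using elim by simp
      also have "\<dots> \<le> 1" using elim by (simp add: divide_le_eq)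
      finally show "\<bar>- (2 / (3 * (1 + R \<epsilon>)))\<bar> \<le> 1" .
    qed simp
    finally show ?case by simp
  qed
  then have "(\<lambda>\<epsilon>. S \<epsilon> - 2/3) \<in> O[at_right 0](\<lambda>\<epsilon>. R \<epsilon> - 1/2)"
    by (intro bigoI[where c = 1]) simp
  then show S23: "(\<lambda>\<epsilon>. S \<epsilon> - 2/3) \<in> O[at_right 0](\<lambda>\<epsilon>. \<epsilon> powr (1/3))"
    using R by (rule landau_o.big_trans)
  have "\<forall>\<^sub>F \<epsilon> in at_right 0. - (S \<epsilon> - 2/3) = E \<epsilon> - 1/3"
    using total by eventually_elim simp
  then have "(\<lambda>\<epsilon>. - (S \<epsilon> - 2/3)) \<in> O[at_right 0](\<lambda>\<epsilon>. \<epsilon> powr (1/3)) \<longleftrightarrow> (\<lambda>\<epsilon>. E \<epsilon> - 1/3) \<in> O[at_right 0](\<lambda>\<epsilon>. \<epsilon> powr (1/3))"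
    by (rule landau_o.big.in_cong)
  then show "(\<lambda>\<epsilon>. E \<epsilon> - 1/3) \<in> O[at_right 0](\<lambda>\<epsilon>. \<epsilon> powr (1/3))"
    using S23 by (simp only: landau_o.big.uminus_in_iff)
qed

end

section \<open>Distribution of the norm over the two edges\<close>

theorem theorem2:
  fixes P :: "complex ^ 2 ^ 2" and T :: "complex ^ 2 \<Rightarrow> complex ^ 2"
    and \<mu> :: "real \<Rightarrow> real" and \<psi> :: "real \<Rightarrow> graph_fun"
  assumes "vertex_conditions P T"
    and "negative_eigenvalue P T \<mu>"
    and "\<forall>\<^sub>F \<epsilon> in at_right 0. normalized_eigenfunction P T \<epsilon> (\<mu> \<epsilon>) (\<psi> \<epsilon>)"
  shows
    "(type_B \<mu> \<longrightarrow>
        (\<lambda>\<epsilon>. (short_norm \<epsilon> (\<psi> \<epsilon>))\<^sup>2) \<in> O[at_right 0](\<lambda>\<epsilon>. \<epsilon>) \<and>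
        (\<lambda>\<epsilon>. (edge_norm (\<psi> \<epsilon>))\<^sup>2 - 1) \<in> O[at_right 0](\<lambda>\<epsilon>. \<epsilon>)) \<and>
     (type_S \<mu> \<longrightarrow>
        (\<lambda>\<epsilon>. (short_norm \<epsilon> (\<psi> \<epsilon>))\<^sup>2 - 1) \<in> O[at_right 0](\<lambda>\<epsilon>. \<epsilon> powr (1/2)) \<and>
        (\<lambda>\<epsilon>. (edge_norm (\<psi> \<epsilon>))\<^sup>2) \<in> O[at_right 0](\<lambda>\<epsilon>. \<epsilon> powr (1/2))) \<and>
     (type_C \<mu> \<longrightarrow>
        (\<lambda>\<epsilon>. (short_norm \<epsilon> (\<psi> \<epsilon>))\<^sup>2 - 2/3) \<in> O[at_right 0](\<lambda>\<epsilon>. \<epsilon> powr (1/3)) \<and>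
        (\<lambda>\<epsilon>. (edge_norm (\<psi> \<epsilon>))\<^sup>2 - 1/3) \<in> O[at_right 0](\<lambda>\<epsilon>. \<epsilon> powr (1/3)))"

proof -
  define \<kappa> where "\<kappa> \<epsilon> = sqrt (- \<mu> \<epsilon>)" for \<epsilon>
  define y z where "y \<epsilon> = vertex_values \<epsilon> (\<psi> \<epsilon>) $ 1" and "z \<epsilon> = vertex_values \<epsilon> (\<psi> \<epsilon>) $ 2" for \<epsilon>
  have ev: "\<forall>\<^sub>F \<epsilon> in at_right 0. 0 < \<epsilon> \<and> 0 < \<kappa> \<epsilon> \<and>
      (P *v vector [y \<epsilon>, z \<epsilon>] = 0 \<and>
      complementary_projection P *v vector [- of_real (\<kappa> \<epsilon> * tanh (\<kappa> \<epsilon> * \<epsilon>)) * y \<epsilon>, - of_real (\<kappa> \<epsilon> / tanh (\<kappa> \<epsilon>)) * z \<epsilon>]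
        = T (complementary_projection P *v vector [y \<epsilon>, z \<epsilon>])) \<and>
      (short_norm \<epsilon> (\<psi> \<epsilon>))\<^sup>2 = (cmod (y \<epsilon>))\<^sup>2 * short_weight \<epsilon> (\<kappa> \<epsilon>) \<and>
      (edge_norm (\<psi> \<epsilon>))\<^sup>2 = (cmod (z \<epsilon>))\<^sup>2 * edge_weight (\<kappa> \<epsilon>) \<and>
      (short_norm \<epsilon> (\<psi> \<epsilon>))\<^sup>2 + (edge_norm (\<psi> \<epsilon>))\<^sup>2 = 1"
    using assms(2)[unfolded negative_eigenvalue_def] assms(3) eventually_at_right_less[of 0]
  proof eventually_elim
    case (elim \<epsilon>)
    have \<kappa>: "0 < \<kappa> \<epsilon>" "\<mu> \<epsilon> = - (\<kappa> \<epsilon>)\<^sup>2" using elim by (auto simp: \<kappa>_def)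
    have eig: "eigenfunction P T \<epsilon> (- (\<kappa> \<epsilon>)\<^sup>2) (\<psi> \<epsilon>)" and norm: "graph_norm \<epsilon> (\<psi> \<epsilon>) = 1"
      using elim(2) \<kappa>(2) by (auto simp: normalized_eigenfunction_def)
    have "P *v vertex_values \<epsilon> (\<psi> \<epsilon>) = 0 \<and> complementary_projection P *v vertex_derivatives \<epsilon> (\<psi> \<epsilon>) =
           T (complementary_projection P *v vertex_values \<epsilon> (\<psi> \<epsilon>))"
      using eig by (simp add: eigenfunction_def H_domain_def)
    moreover obtain y' z' where form: "vertex_values \<epsilon> (\<psi> \<epsilon>) = vector [y', z']"
      "vertex_derivatives \<epsilon> (\<psi> \<epsilon>) = vector [- of_real (\<kappa> \<epsilon> * tanh (\<kappa> \<epsilon> * \<epsilon>)) * y', - of_real (\<kappa> \<epsilon> / tanh (\<kappa> \<epsilon>)) * z']"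
      "(short_norm \<epsilon> (\<psi> \<epsilon>))\<^sup>2 = (cmod y')\<^sup>2 * short_weight \<epsilon> (\<kappa> \<epsilon>)"
      "(edge_norm (\<psi> \<epsilon>))\<^sup>2 = (cmod z')\<^sup>2 * edge_weight (\<kappa> \<epsilon>)"
      using eigenfunction_vertex_form[OF eig \<kappa>(1) elim(3)] by blast
    moreover have "y' = y \<epsilon>" "z' = z \<epsilon>" by (simp_all add: y_def z_def form(1))
    moreover have "(short_norm \<epsilon> (\<psi> \<epsilon>))\<^sup>2 + (edge_norm (\<psi> \<epsilon>))\<^sup>2 = 1"
      using norm by (simp add: graph_norm_def)
    ultimately show ?case using elim(3) \<kappa>(1) by (simp only: simp_thms)
  qed
  interpret eigenfunction_branch P T \<kappa> y z "\<lambda>\<epsilon>. (short_norm \<epsilon> (\<psi> \<epsilon>))\<^sup>2" "\<lambda>\<epsilon>. (edge_norm (\<psi> \<epsilon>))\<^sup>2"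
    by unfold_locales (fact assms(1), (rule eventually_mono[OF ev]; blast)+)
  show ?thesis
  proof (intro conjI[of "_ \<longrightarrow> _" "_ \<and> _"] conjI[of "_ \<longrightarrow> _" "_ \<longrightarrow> _"] impI)
    assume "type_B \<mu>"
    then obtain \<alpha> where "\<alpha> > 0" and \<alpha>: "(\<lambda>\<epsilon>. \<mu> \<epsilon> - (- \<alpha>)) \<in> O[at_right 0](\<lambda>\<epsilon>. \<epsilon>)"
      unfolding type_B_def by blast
    have "\<forall>\<^sub>F \<epsilon> in at_right 0. \<mu> \<epsilon> - (- \<alpha>) = \<mu> \<epsilon> + \<alpha> * \<epsilon> powr (- 2 * 0)"
      using eventually_at_right_less[of 0] by eventually_elim simp
    then have "(\<lambda>\<epsilon>. \<mu> \<epsilon> + \<alpha> * \<epsilon> powr (- 2 * 0)) \<in> O[at_right 0](\<lambda>\<epsilon>. \<epsilon>)"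
      using \<alpha> by (simp only: landau_o.big.in_cong)
    also have "(\<lambda>\<epsilon>. \<epsilon>) \<in> o[at_right 0](\<lambda>\<epsilon>::real. \<epsilon> powr (- 2 * 0))" by real_asymp
    finally have *: "(\<lambda>\<epsilon>. \<mu> \<epsilon> + \<alpha> * \<epsilon> powr (- 2 * 0)) \<in> o[at_right 0](\<lambda>\<epsilon>. \<epsilon> powr (- 2 * 0))" .
    obtain c C where "c > 0" and \<kappa>: "\<forall>\<^sub>F \<epsilon> in at_right 0. c * \<epsilon> powr (- 0) \<le> sqrt (- \<mu> \<epsilon>) \<and> sqrt (- \<mu> \<epsilon>) \<le> C * \<epsilon> powr (- 0)"
      by (rule wave_number_bounds[OF \<open>\<alpha> > 0\<close> *])
    have "\<forall>\<^sub>F \<epsilon> in at_right 0. c \<le> \<kappa> \<epsilon> \<and> \<kappa> \<epsilon> \<le> C"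
      using \<kappa> eventually_at_right_less[of 0] by eventually_elim (simp add: \<kappa>_def)
    then show "(\<lambda>\<epsilon>. (short_norm \<epsilon> (\<psi> \<epsilon>))\<^sup>2) \<in> O[at_right 0](\<lambda>\<epsilon>. \<epsilon>) \<and>
        (\<lambda>\<epsilon>. (edge_norm (\<psi> \<epsilon>))\<^sup>2 - 1) \<in> O[at_right 0](\<lambda>\<epsilon>. \<epsilon>)"
      using bounded_wave_number[OF \<open>c > 0\<close>] by blast
  next
    assume "type_S \<mu>"
    then obtain \<alpha> where "\<alpha> > 0" and \<alpha>: "(\<lambda>\<epsilon>. \<mu> \<epsilon> - (- \<alpha> * \<epsilon> powr (-1))) \<in> O[at_right 0](\<lambda>\<epsilon>. \<epsilon> powr (-1/2))"
      unfolding type_S_def by blast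
    have "(\<lambda>\<epsilon>. \<mu> \<epsilon> + \<alpha> * \<epsilon> powr (- 2 * (1/2))) \<in> O[at_right 0](\<lambda>\<epsilon>. \<epsilon> powr (-1/2))"
      using \<alpha> by simp
    also have "(\<lambda>\<epsilon>. \<epsilon> powr (-1/2)) \<in> o[at_right 0](\<lambda>\<epsilon>::real. \<epsilon> powr (- 2 * (1/2)))" by real_asymp
    finally have *: "(\<lambda>\<epsilon>. \<mu> \<epsilon> + \<alpha> * \<epsilon> powr (- 2 * (1/2))) \<in> o[at_right 0](\<lambda>\<epsilon>. \<epsilon> powr (- 2 * (1/2)))" .
    obtain c C where "c > 0" "\<forall>\<^sub>F \<epsilon> in at_right 0. c * \<epsilon> powr (- (1/2)) \<le> sqrt (- \<mu> \<epsilon>) \<and> sqrt (- \<mu> \<epsilon>) \<le> C * \<epsilon> powr (- (1/2))"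
      by (rule wave_number_bounds[OF \<open>\<alpha> > 0\<close> *])
    then show "(\<lambda>\<epsilon>. (short_norm \<epsilon> (\<psi> \<epsilon>))\<^sup>2 - 1) \<in> O[at_right 0](\<lambda>\<epsilon>. \<epsilon> powr (1/2)) \<and>
        (\<lambda>\<epsilon>. (edge_norm (\<psi> \<epsilon>))\<^sup>2) \<in> O[at_right 0](\<lambda>\<epsilon>. \<epsilon> powr (1/2))"
      using wave_number_of_order_half[of c C] unfolding \<kappa>_def by blast
  next
    assume "type_C \<mu>"
    then obtain \<alpha> where "\<alpha> > 0" and \<alpha>: "(\<lambda>\<epsilon>. \<mu> \<epsilon> - (- \<alpha> * \<epsilon> powr (-2/3))) \<in> O[at_right 0](\<lambda>\<epsilon>. \<epsilon> powr (-1/3))"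
      unfolding type_C_def by blast
    have "(\<lambda>\<epsilon>. \<mu> \<epsilon> + \<alpha> * \<epsilon> powr (- 2 * (1/3))) \<in> O[at_right 0](\<lambda>\<epsilon>. \<epsilon> powr (-1/3))"
      using \<alpha> by simp
    also have "(\<lambda>\<epsilon>. \<epsilon> powr (-1/3)) \<in> o[at_right 0](\<lambda>\<epsilon>::real. \<epsilon> powr (- 2 * (1/3)))" by real_asymp
    finally have *: "(\<lambda>\<epsilon>. \<mu> \<epsilon> + \<alpha> * \<epsilon> powr (- 2 * (1/3))) \<in> o[at_right 0](\<lambda>\<epsilon>. \<epsilon> powr (- 2 * (1/3)))" .
    obtain c C where "c > 0" "C > 0" "\<forall>\<^sub>F \<epsilon> in at_right 0. c * \<epsilon> powr (- (1/3)) \<le> sqrt (- \<mu> \<epsilon>) \<and> sqrt (- \<mu> \<epsilon>) \<le> C * \<epsilon> powr (- (1/3))"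
      by (rule wave_number_bounds[OF \<open>\<alpha> > 0\<close> *])
    then show "(\<lambda>\<epsilon>. (short_norm \<epsilon> (\<psi> \<epsilon>))\<^sup>2 - 2/3) \<in> O[at_right 0](\<lambda>\<epsilon>. \<epsilon> powr (1/3)) \<and>
        (\<lambda>\<epsilon>. (edge_norm (\<psi> \<epsilon>))\<^sup>2 - 1/3) \<in> O[at_right 0](\<lambda>\<epsilon>. \<epsilon> powr (1/3))"
      using wave_number_of_order_third[of c C] unfolding \<kappa>_def by blast
  qed
qed

end
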